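(* As $n \to \infty$, \[ c_n^{(2)} \sim \frac{e^{2\pi \sqrt{n}}}{2n^{3/4}} \times \begin{cases} -1 & (n \equiv 0 \bmod 2), \\ 1 & (n \equiv 1 \bmod 2), \end{cases} \qquad c_n^{(3)} \sim \frac{e^{4\pi \sqrt{n}/3}}{\sqrt{6}\,n^{3/4}} \times \begin{cases} -1 & (n \equiv 0, 2 \bmod 3), \\ 2 & (n \equiv 1 \bmod 3), \end{cases} \] \[ c_n^{(5)} \sim \frac{e^{4\pi \sqrt{n}/5}}{\sqrt{10}\,n^{3/4}} \times \begin{cases} -1 & (n \equiv 0 \bmod 5), \\ (3 + \sqrt{5})/2 & (n \equiv 1 \bmod 5), \\ -1 + \sqrt{5} & (n \equiv 2 \bmod 5), \\ -1 - \sqrt{5} & (n \equiv 3 \bmod 5), \\ (3 - \sqrt{5})/2 & (n \equiv 4 \bmod 5), \end{cases} \] where $a_n \sim b_n$ means $a_n/b_n \to 1$ as $n\to\infty$ (within each indicated residue class).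
   Context: Let $q = e^{2\pi i \tau}$ and $\eta(\tau) = q^{1/24}\prod_{n\ge1}(1-q^n)$. For $p = 2,3,5$ let $e_2 = 24$, $e_3 = 12$, $e_5 = 6$, and let $j_p(\tau) = (\eta(\tau)/\eta(p\tau))^{e_p} + e_p = q^{-1} + \sum_{n \ge 1} c_n^{(p)} q^n$ be the Hauptmodul of $\Gamma_0(p)$; $c_n^{(p)}$ denotes its $n$th Fourier coefficient. *)

theory Defs
  imports "HOL-Complex_Analysis.Complex_Analysis" "HOL-Library.Landau_Symbols"
begin

definition nome :: "complex \<Rightarrow> complex" where
  "nome \<tau> = exp (2 * of_real pi * \<i> * \<tau>)"

text \<open>The factor \<open>q\<^sup>1\<^sup>/\<^sup>2\<^sup>4\<close> means \<open>exp (2 \<pi> \<i> \<tau> / 24)\<close>,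
  not a principal root of \<open>q\<close>.\<close>

definition dedekind_eta :: "complex \<Rightarrow> complex" where
  "dedekind_eta \<tau> = exp (2 * of_real pi * \<i> * \<tau> / 24) * (\<Prod>n. 1 - nome \<tau> ^ Suc n)"

text \<open>Only the values at 2, 3 and 5 matter; the value 0 elsewhere is a dummy.\<close>

definition eta_exponent :: "nat \<Rightarrow> nat" where
  "eta_exponent p = (if p = 2 then 24 else if p = 3 then 12 else if p = 5 then 6 else 0)"

definition hauptmodul :: "nat \<Rightarrow> complex \<Rightarrow> complex" where
  "hauptmodul p \<tau> =
     (dedekind_eta \<tau> / dedekind_eta (of_nat p * \<tau>)) ^ eta_exponent p + of_nat (eta_exponent p)"

text \<open>
  The sequence of Fourier coefficients of nonnegative index is determined by the expansion
  \<open>j\<^sub>p(\<tau>) = q\<^sup>-\<^sup>1 + (\<Sum>n\<ge>0. c\<^sub>n q\<^sup>n)\<close> on the upper half-plane. That exactly one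
  such sequence exists, and that its constant term vanishes, is proved below in
  \<open>hauptmodul_q_expansion_unique\<close> and \<open>hauptmodul_coeff_0\<close>.
\<close>

definition hauptmodul_coeff :: "nat \<Rightarrow> nat \<Rightarrow> complex" where
  "hauptmodul_coeff p = (THE c. \<forall>\<tau>. Im \<tau> > 0 \<longrightarrow>
     (\<lambda>n. c n * nome \<tau> ^ n) sums (hauptmodul p \<tau> - inverse (nome \<tau>)))"

definition euler_prod :: "complex \<Rightarrow> complex" where
  "euler_prod q = (\<Prod>n. 1 - q ^ Suc n)"

lemma norm_nome: "norm (nome \<tau>) = exp (- 2 * pi * Im \<tau>)"
  by (simp add: nome_def norm_exp_eq_Re)

lemma norm_nome_less_1: "Im \<tau> > 0 \<Longrightarrow> norm (nome \<tau>) < 1"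
  by (simp add: norm_nome)

lemma nome_nonzero [simp]: "nome \<tau> \<noteq> 0"
  by (simp add: nome_def)

lemma nome_of_nat_mult: "nome (of_nat p * \<tau>) = nome \<tau> ^ p"
  by (simp add: nome_def exp_of_nat_mult [symmetric] mult_ac)

lemma nome_surj:
  assumes "q \<noteq> 0" "norm q < 1"
  obtains \<tau> where "Im \<tau> > 0" "nome \<tau> = q"
proof
  define \<tau> where "\<tau> = Ln q / (2 * of_real pi * \<i>)"
  have "2 * of_real pi * \<i> * \<tau> = Ln q"
    by (simp add: \<tau>_def)
  then show eq: "nome \<tau> = q"
    using assms by (simp add: nome_def)
  have "exp (- 2 * pi * Im \<tau>) < 1"
    using assms(2) norm_nome [of \<tau>] eq by simp
  then show "Im \<tau> > 0"
    by (simp add: zero_less_mult_iff)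
qed

lemma abs_convergent_euler_prod:
  fixes q :: complex
  assumes "norm q < 1"
  shows "abs_convergent_prod (\<lambda>n. 1 - q ^ Suc n)"
proof (rule summable_imp_abs_convergent_prod)
  have "summable (\<lambda>n. norm q ^ Suc n)"
    using assms by (intro summable_mult summable_geometric | simp)+
  then show "summable (\<lambda>n. norm (1 - q ^ Suc n - 1))"
    by (simp add: norm_mult norm_power)
qed

lemma power_Suc_neq_1:
  fixes q :: complex
  assumes "norm q < 1"
  shows "q ^ Suc n \<noteq> 1"
proof
  assume "q ^ Suc n = 1"
  then have "norm q ^ Suc n = 1"
    by (metis norm_one norm_power)
  moreover have "norm q ^ Suc n < 1"
    using assms power_Suc_less_one [of "norm q" n] by (cases "q = 0") auto
  ultimately show False by simp
qed

lemma euler_prod_nonzero: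
  assumes "norm q < 1"
  shows "euler_prod q \<noteq> 0"
  unfolding euler_prod_def
  using abs_convergent_prod_imp_convergent_prod [OF abs_convergent_euler_prod [OF assms]]
    power_Suc_neq_1 [OF assms]
  by (intro prodinf_nonzero) (auto simp del: power_Suc)

lemma euler_prod_uniform_limit:
  assumes "r < 1"
  shows "uniform_limit (cball 0 r) (\<lambda>N q. \<Prod>n<N. 1 - q ^ Suc n) euler_prod sequentially"
proof (cases "r \<ge> 0")
  case True
  have "uniformly_convergent_on (cball 0 r) (\<lambda>N q :: complex. \<Prod>n<N. 1 - q ^ Suc n)"
  proof (rule uniformly_convergent_on_prod')
    show "uniformly_convergent_on (cball 0 r)
            (\<lambda>N q :: complex. \<Sum>n<N. norm (1 - q ^ Suc n - 1))"
    proof (rule Weierstrass_m_test')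
      have "summable (\<lambda>n. r * r ^ n)"
        using True assms by (intro summable_mult summable_geometric) auto
      then show "summable (\<lambda>n. r ^ Suc n)"
        by simp
      show "norm (norm (1 - q ^ Suc n - 1)) \<le> r ^ Suc n" if "q \<in> cball 0 r" for n and q :: complex
        using that power_mono [of "norm q" r "Suc n"]
        by (simp add: norm_power norm_mult del: power_Suc)
    qed
  qed (auto intro!: continuous_intros)
  then have "uniform_limit (cball 0 r) (\<lambda>N q. \<Prod>n<N. 1 - q ^ Suc n)
      (\<lambda>q :: complex. lim (\<lambda>N. \<Prod>n<N. 1 - q ^ Suc n)) sequentially"
    by (simp add: uniformly_convergent_uniform_limit_iff)
  moreover have "lim (\<lambda>N. \<Prod>n<N. 1 - q ^ Suc n) = euler_prod q" if "q \<in> cball 0 r" for q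
  proof -
    from that assms have "norm q < 1" by auto
    from abs_convergent_prod_imp_convergent_prod [OF abs_convergent_euler_prod [OF this]]
    show ?thesis unfolding euler_prod_def
      by (rule prodinf_eq_lim' [symmetric])
        (use power_Suc_neq_1 [OF \<open>norm q < 1\<close>] in \<open>auto simp del: power_Suc\<close>)
  qed
  ultimately show ?thesis
    by (subst uniform_limit_cong') (auto simp del: power_Suc)
qed (auto simp: not_le)

lemma euler_prod_holomorphic: "euler_prod holomorphic_on ball 0 1"
proof (rule holomorphic_uniform_sequence)
  fix q :: complex
  assume q: "q \<in> ball 0 1"
  define r where "r = (1 + norm q) / 2"
  have r: "norm q < r" "r < 1"
    using q by (auto simp: r_def)
  have sub: "cball q (r - norm q) \<subseteq> cball 0 r"
  proof
    fix z assume "z \<in> cball q (r - norm q)"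
    then show "z \<in> cball 0 r"
      using norm_triangle_ineq2 [of z q] by (auto simp: dist_norm norm_minus_commute)
  qed
  show "\<exists>d>0. cball q d \<subseteq> ball 0 1 \<and>
      uniform_limit (cball q d) (\<lambda>N q. \<Prod>n<N. 1 - q ^ Suc n) euler_prod sequentially"
  proof (intro exI conjI)
    show "cball q (r - norm q) \<subseteq> ball 0 1"
      using sub r by (force simp: subset_iff)
    show "uniform_limit (cball q (r - norm q)) (\<lambda>N q. \<Prod>n<N. 1 - q ^ Suc n) euler_prod sequentially"
      using euler_prod_uniform_limit [OF r(2)] sub by (rule uniform_limit_on_subset)
  qed (use r in auto)
qed (auto intro!: holomorphic_intros)

lemma euler_prod_0 [simp]: "euler_prod 0 = 1"
  by (simp add: euler_prod_def)

lemma deriv_euler_prod_0: "deriv euler_prod 0 = -1"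
proof -
  define f :: "nat \<Rightarrow> complex \<Rightarrow> complex" where "f = (\<lambda>N q. \<Prod>n<N. 1 - q ^ Suc n)"
  have f0: "f N 0 = 1" for N
    by (simp add: f_def)
  have f': "(f (Suc N) has_field_derivative -1) (at 0)" for N
  proof (induction N)
    case 0
    show ?case by (auto simp: f_def intro!: derivative_eq_intros)
  next
    case (Suc N)
    have "f (Suc (Suc N)) = (\<lambda>q. f (Suc N) q * (1 - q * (q * q ^ N)))"
      by (simp add: f_def fun_eq_iff)
    moreover have "((\<lambda>q. f (Suc N) q * (1 - q * (q * q ^ N))) has_field_derivative -1) (at 0)"
      using f0 by (auto intro!: derivative_eq_intros Suc.IH)
    ultimately show ?case by simp
  qed
  have "(\<lambda>N. (deriv ^^ 1) (f N) 0) \<longlonglongrightarrow> (deriv ^^ 1) euler_prod 0"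
  proof (rule higher_deriv_complex_uniform_limit)
    show "uniform_limit (ball 0 (1/2)) f euler_prod sequentially"
      unfolding f_def
      by (rule uniform_limit_on_subset [OF euler_prod_uniform_limit [of "1/2"]]) auto
    show "\<forall>\<^sub>F N in sequentially. f N holomorphic_on ball 0 (1/2)"
      unfolding f_def by (auto intro!: holomorphic_intros always_eventually)
  qed auto
  then have "(\<lambda>N. deriv (f (Suc N)) 0) \<longlonglongrightarrow> deriv euler_prod 0"
    using LIMSEQ_Suc by fastforce
  moreover have "deriv (f (Suc N)) 0 = -1" for N
    by (rule DERIV_imp_deriv [OF f'])
  ultimately show ?thesis
    using LIMSEQ_unique [OF _ tendsto_const] by fastforce
qed

definition euler_quot :: "nat \<Rightarrow> complex \<Rightarrow> complex" where
  "euler_quot p q = (euler_prod q / euler_prod (q ^ p)) ^ eta_exponent p"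

lemma hauptmodul_eq_euler_quot:
  assumes "p \<in> {2, 3, 5}"
  shows "hauptmodul p \<tau> = inverse (nome \<tau>) * euler_quot p (nome \<tau>) + of_nat (eta_exponent p)"
proof -
  let ?a = "2 * of_real pi * \<i> * \<tau>"
  have "(exp (?a / 24) / exp (2 * of_real pi * \<i> * (of_nat p * \<tau>) / 24)) ^ eta_exponent p
        = exp (of_nat (eta_exponent p) * (?a / 24 - 2 * of_real pi * \<i> * (of_nat p * \<tau>) / 24))"
    by (simp add: exp_diff [symmetric] exp_of_nat_mult)
  also have "of_nat (eta_exponent p) * (?a / 24 - 2 * of_real pi * \<i> * (of_nat p * \<tau>) / 24) = - ?a"
    using assms by (auto simp: eta_exponent_def field_simps)
  finally have "(exp (?a / 24) / exp (2 * of_real pi * \<i> * (of_nat p * \<tau>) / 24)) ^ eta_exponent p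
      = inverse (nome \<tau>)"
    by (simp add: nome_def exp_minus)
  then show ?thesis
    unfolding hauptmodul_def dedekind_eta_def euler_quot_def nome_of_nat_mult
      euler_prod_def [symmetric] times_divide_times_eq [symmetric] power_mult_distrib
    by simp
qed

lemma norm_power_less_1:
  fixes q :: complex
  assumes "norm q < 1" "p > 0"
  shows "norm (q ^ p) < 1"
  using assms by (simp add: norm_power power_less_one_iff)

lemma euler_quot_holomorphic:
  assumes "p > 0"
  shows "euler_quot p holomorphic_on ball 0 1"
proof -
  have "(\<lambda>q. euler_prod (q ^ p)) holomorphic_on ball 0 1"
    by (rule holomorphic_on_compose_gen [OF _ euler_prod_holomorphic, unfolded o_def])
      (use norm_power_less_1 [OF _ assms] in \<open>auto intro!: holomorphic_intros\<close>)
  then show ?thesis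
    unfolding euler_quot_def
    using euler_prod_nonzero norm_power_less_1 [OF _ assms]
    by (intro holomorphic_intros euler_prod_holomorphic) auto
qed

lemma deriv_euler_quot_0:
  assumes "p \<ge> 2"
  shows "deriv (euler_quot p) 0 = - of_nat (eta_exponent p)"
proof -
  have D: "(euler_prod has_field_derivative -1) (at 0)"
    using holomorphic_derivI [OF euler_prod_holomorphic, of 0] deriv_euler_prod_0 by simp
  have p: "(0::complex) ^ p = 0" "(0::complex) ^ (p - Suc 0) = 0"
    using assms by auto
  have "((\<lambda>q. euler_prod (q ^ p)) has_field_derivative (-1) * (of_nat p * 0 ^ (p - Suc 0))) (at 0)"
    by (rule DERIV_chain2 [of euler_prod]) (use D p in \<open>auto simp: p intro!: derivative_eq_intros\<close>)
  then have Dp: "((\<lambda>q. euler_prod (q ^ p)) has_field_derivative 0) (at 0)"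
    using p by simp
  have "((\<lambda>q. euler_prod q / euler_prod (q ^ p)) has_field_derivative -1) (at 0)"
    using DERIV_divide [OF D Dp] p by simp
  from DERIV_power [OF this, of "eta_exponent p"]
  have "(euler_quot p has_field_derivative - of_nat (eta_exponent p)) (at 0)"
    using p by (simp add: euler_quot_def [abs_def])
  then show ?thesis by (rule DERIV_imp_deriv)
qed

lemma hauptmodul_q_expansion_exists:
  assumes p: "p \<in> {2, 3, 5}"
  obtains c where "c 0 = 0"
    "\<And>\<tau>. Im \<tau> > 0 \<Longrightarrow> (\<lambda>n. c n * nome \<tau> ^ n) sums (hauptmodul p \<tau> - inverse (nome \<tau>))"
proof -
  define a where "a = (\<lambda>n. (deriv ^^ n) (euler_quot p) 0 / fact n)"
  define c where "c = (\<lambda>n. a (Suc n) + (if n = 0 then of_nat (eta_exponent p) else 0))"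
  have p2: "p \<ge> 2" using p by auto
  have c0: "c 0 = 0"
    using deriv_euler_quot_0 [OF p2] by (simp add: c_def a_def)
  have c_sums: "(\<lambda>n. c n * nome \<tau> ^ n) sums (hauptmodul p \<tau> - inverse (nome \<tau>))"
    if "Im \<tau> > 0" for \<tau>
  proof -
    define q where "q = nome \<tau>"
    have q: "q \<noteq> 0" "norm q < 1"
      using norm_nome_less_1 [OF \<open>Im \<tau> > 0\<close>] by (auto simp: q_def)
    have a0: "a 0 = 1"
      using p2 by (simp add: a_def euler_quot_def power_0_left)
    have "(\<lambda>n. a n * q ^ n) sums euler_quot p q"
      using holomorphic_power_series [OF euler_quot_holomorphic, of p q] p2 q by (simp add: a_def)
    then have "(\<lambda>n. a (Suc n) * q ^ Suc n) sums (euler_quot p q - 1)"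
      using a0 by (subst sums_Suc_iff) simp
    then have "(\<lambda>n. inverse q * (a (Suc n) * q ^ Suc n)) sums (inverse q * (euler_quot p q - 1))"
      by (rule sums_mult)
    then have "(\<lambda>n. a (Suc n) * q ^ n) sums (inverse q * euler_quot p q - inverse q)"
      using q by (simp add: field_simps)
    from sums_add [OF this sums_single [of 0 "\<lambda>_. of_nat (eta_exponent p)"]]
    have "(\<lambda>n. a (Suc n) * q ^ n + (if n = 0 then of_nat (eta_exponent p) else 0)) sums
            (inverse q * euler_quot p q - inverse q + of_nat (eta_exponent p))" .
    moreover have "(\<lambda>n. a (Suc n) * q ^ n + (if n = 0 then of_nat (eta_exponent p) else 0))
        = (\<lambda>n. c n * q ^ n)"
      by (auto simp: c_def fun_eq_iff)
    ultimately show ?thesis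
      unfolding hauptmodul_eq_euler_quot [OF p] q_def [symmetric] by (simp add: algebra_simps)
  qed
  from c0 c_sums show ?thesis by (rule that)
qed

lemma q_expansion_unique:
  assumes c: "\<And>\<tau>. Im \<tau> > 0 \<Longrightarrow> (\<lambda>n. c n * nome \<tau> ^ n) sums f \<tau>"
    and d: "\<And>\<tau>. Im \<tau> > 0 \<Longrightarrow> (\<lambda>n. d n * nome \<tau> ^ n) sums f \<tau>"
  shows "c = d"
proof (rule ccontr)
  assume "c \<noteq> d"
  then obtain m where m: "c m - d m \<noteq> 0" and least: "\<And>k. k < m \<Longrightarrow> c k - d k = 0"
    using exists_least_iff [of "\<lambda>n. c n - d n \<noteq> 0"] by (auto simp: fun_eq_iff)
  define g where "g = (\<lambda>n. c (n + m) - d (n + m))"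
  have g: "(\<lambda>n. g n * q ^ n) sums 0" if q: "q \<noteq> 0" "norm q < 1" for q
  proof -
    obtain \<tau> where t: "Im \<tau> > 0" "nome \<tau> = q"
      using nome_surj [OF q] .
    have "(\<lambda>n. (c n - d n) * q ^ n) sums 0"
      using sums_diff [OF c [OF t(1)] d [OF t(1)]] t(2) by (simp add: algebra_simps)
    then have "(\<lambda>n. (c (n + m) - d (n + m)) * q ^ (n + m)) sums 0"
      using sums_iff_shift [of "\<lambda>n. (c n - d n) * q ^ n" m 0] least by simp
    from sums_mult [OF this, of "inverse (q ^ m)"]
    have "(\<lambda>n. inverse (q ^ m) * (g n * q ^ (n + m))) sums 0"
      by (simp add: g_def)
    moreover have "inverse (q ^ m) * (g n * q ^ (n + m)) = g n * q ^ n" for n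
      using q by (simp add: power_add field_simps)
    ultimately show ?thesis by simp
  qed
  have "((\<lambda>q. 0) \<longlongrightarrow> g 0) (at (0::complex))"
    using powser_limit_0_strong [of 1 g "\<lambda>_. 0"] g by auto
  then have "g 0 = 0"
    using LIM_const_eq by metis
  then show False
    using m by (simp add: g_def)
qed

lemma hauptmodul_q_expansion_unique:
  assumes "p \<in> {2, 3, 5}"
  shows "\<exists>!c. \<forall>\<tau>. Im \<tau> > 0 \<longrightarrow>
     (\<lambda>n. c n * nome \<tau> ^ n) sums (hauptmodul p \<tau> - inverse (nome \<tau>))"
proof (rule ex_ex1I)
  show "\<exists>c. \<forall>\<tau>. Im \<tau> > 0 \<longrightarrow>
      (\<lambda>n. c n * nome \<tau> ^ n) sums (hauptmodul p \<tau> - inverse (nome \<tau>))"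
    using hauptmodul_q_expansion_exists [OF assms] by metis
qed (auto intro: q_expansion_unique)

lemma hauptmodul_q_expansion:
  assumes "p \<in> {2, 3, 5}" "Im \<tau> > 0"
  shows "(\<lambda>n. hauptmodul_coeff p n * nome \<tau> ^ n) sums (hauptmodul p \<tau> - inverse (nome \<tau>))"
  using theI' [OF hauptmodul_q_expansion_unique [OF assms(1)]] assms(2)
  unfolding hauptmodul_coeff_def by blast

lemma hauptmodul_coeff_0:
  assumes "p \<in> {2, 3, 5}"
  shows "hauptmodul_coeff p 0 = 0"
proof -
  obtain c where c: "c 0 = 0"
    "\<And>\<tau>. Im \<tau> > 0 \<Longrightarrow> (\<lambda>n. c n * nome \<tau> ^ n) sums (hauptmodul p \<tau> - inverse (nome \<tau>))"
    using hauptmodul_q_expansion_exists [OF assms] by blast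
  have "hauptmodul_coeff p = c"
    using hauptmodul_q_expansion [OF assms] c(2) by (rule q_expansion_unique)
  with c(1) show ?thesis by simp
qed

end

theory Submission
  imports Defs "HOL-Probability.Distributions" "HOL-Real_Asymp.Real_Asymp"
begin

text \<open>
  No modular transformation is needed: \<open>(\<eta>(\<tau>) / \<eta>(p \<tau>))\<^sup>e\<close> is \<open>1/q\<close> times
  \<open>\<Prod>(1 - q\<^sup>n)\<^sup>e\<close> over the \<open>n\<close> prime to \<open>p\<close>. Near a primitive \<open>p\<close>-th root of unity, at
  \<open>q = \<zeta> exp (-t)\<close>, every factor stays away from 0, so an Euler--Maclaurin summation of the
  logarithms gives \<open>C exp (A\<^sup>2 / t) (1 + O(t))\<close> with \<open>A = 2 \<pi> / p\<close>; the exponent comes from dilogarithms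
  of roots of unity. Elsewhere the Lambert series \<open>- ln \<bar>\<Prod>(1 - q\<^sup>n)\<bar> = \<Sum> Re (q\<^sup>m / (1 - q\<^sup>m)) / m\<close>
  is bounded term by term: its terms with \<open>p\<close> not dividing \<open>m\<close> contribute only a power of \<open>1/t\<close>, and
  the trivial bound for the others already has the constant \<open>A\<^sup>2\<close>, with a strict saving off the main arcs.
  On \<open>\<bar>q\<bar> = exp (- A / \<surd>n)\<close> the saddle point method then yields a Gaussian integral for each
  primitive \<open>p\<close>-th root of unity.
\<close>

subsection \<open>Asymptotics of infinite products near a root of unity\<close>

text \<open>On an arc of half-width \<pi>/p around a p-th root of unity the phase of
  \<open>q^p\<close> makes one full turn and is 0 only at the centre; so \<open>q^p\<close>, whose
  Lambert terms alone produce the exponential growth, is near 1 only around the p centres. The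
  trivial bound has no room in its constant: it gives e (1 - 1/p) \<zeta>(2) / p, which equals (2
  \<pi>/p)^2 because e (p - 1) = 24, the same identity that fixes the exponent of the main term. A
  fixed relative saving in one single Lambert term is nevertheless enough, since exp (-\<epsilon>/s)
  beats every power of 1/s. The centre 1 needs a separate argument: there \<open>q^p\<close> is near
  1 and nothing is saved, but \<open>q\<close> itself is near 1 as well, and its own large Lambert
  term enters with a negative sign. The constants C belonging to \<zeta>^a turn out to be p-th roots
  of unity, with phases given by Dedekind sums, so that the sum of C \<zeta>^(-a(n+1)) over a
  depends only on n mod p. It vanishes in no residue class for p = 2, 3, 5, and this is what turns a
  limit of differences into a limit of quotients.\<close>

definition dilog :: "complex \<Rightarrow> complex" where
  "dilog z = (\<Sum>n. z ^ Suc n / of_nat (Suc n) ^ 2)"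

lemma inverse_squares_summable: "summable (\<lambda>n. 1 / real (Suc n) ^ 2)"
  using inverse_squares_sums by (simp add: sums_iff add_ac)

lemma norm_dilog_term_le:
  assumes "norm z \<le> 1"
  shows "norm (z ^ Suc n / of_nat (Suc n) ^ 2 :: complex) \<le> 1 / real (Suc n) ^ 2"
proof -
  have "norm z ^ Suc n \<le> 1"
    using assms by (intro power_le_one) auto
  then show ?thesis
    unfolding norm_divide norm_power norm_of_nat by (intro divide_right_mono) auto
qed

lemma dilog_sums:
  assumes "norm z \<le> 1"
  shows "(\<lambda>n. z ^ Suc n / of_nat (Suc n) ^ 2) sums dilog z"
  unfolding dilog_def
  by (intro summable_sums summable_comparison_test' [OF inverse_squares_summable, of 0]
      norm_dilog_term_le assms)

text \<open>Continuity is needed up to the boundary: the summation starts at \<open>u = 0\<close>,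
  where \<open>w * exp (- u)\<close> has modulus 1, and the step estimate gets there only as a
  limit.\<close>

lemma continuous_on_dilog: "continuous_on (cball 0 1) dilog"
proof (rule uniform_limit_theorem)
  show "uniform_limit (cball 0 1) (\<lambda>N z. \<Sum>n<N. z ^ Suc n / of_nat (Suc n) ^ 2) dilog sequentially"
    unfolding dilog_def [abs_def]
    by (rule Weierstrass_m_test [OF _ inverse_squares_summable]) (use norm_dilog_term_le in auto)
qed (auto intro!: always_eventually continuous_intros simp del: of_nat_Suc)

lemma dilog_0 [simp]: "dilog 0 = 0"
  by (simp add: dilog_def)

text \<open>Multiplying the derivative by \<open>z\<close> avoids the removable singularity of -Ln(1
  - z)/z at 0, and \<open>z * D\<close> is exactly what the chain rule for
  \<open>z = w * exp (- u)\<close> asks for.\<close>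

lemma dilog_has_field_derivative:
  assumes z: "norm z < 1"
  obtains D where "(dilog has_field_derivative D) (at z)" "z * D = - Ln (1 - z)"
proof -
  \<comment> \<open>\<open>c 0 = 1 / 0 = 0\<close>, so the dilogarithm becomes a power series
    indexed from 0.\<close>
  define c :: "nat \<Rightarrow> complex" where "c = (\<lambda>n. 1 / of_nat n ^ 2)"
  have c: "(\<lambda>n. c n * x ^ n) sums dilog x" if "norm x \<le> 1" for x
  proof -
    have "(\<lambda>n. c (Suc n) * x ^ Suc n) sums dilog x"
      using dilog_sums [OF that] by (simp add: c_def)
    then show ?thesis
      by (subst (asm) sums_Suc_iff) (simp add: c_def)
  qed
  then have dl: "dilog x = (\<Sum>n. c n * x ^ n)" if "norm x \<le> 1" for x
    using that by (simp add: sums_iff)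
  have "summable (\<lambda>n. c n * 1 ^ n)"
    using c [of 1] by (simp add: sums_iff)
  from termdiffs_strong [OF this, of z]
  have D: "((\<lambda>x. \<Sum>n. c n * x ^ n) has_field_derivative (\<Sum>n. diffs c n * z ^ n)) (at z)"
    using z by simp
  have "(dilog has_field_derivative (\<Sum>n. diffs c n * z ^ n)) (at z)"
    by (rule has_field_derivative_transform_within_open [OF D, of "ball 0 1"]) (use z dl in auto)
  moreover have "z * (\<Sum>n. diffs c n * z ^ n) = - Ln (1 - z)"
  proof -
    have "(\<lambda>n. - (z ^ n) / of_nat n) sums Ln (1 - z)"
      using Ln_series' [of "- z"] z by simp
    then have "(\<lambda>n. - (z ^ Suc n) / of_nat (Suc n)) sums Ln (1 - z)"
      by (subst sums_Suc_iff) simp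
    from sums_minus [OF this] have s: "(\<lambda>n. z ^ Suc n / of_nat (Suc n)) sums - Ln (1 - z)"
      by simp
    have eq: "z * (diffs c n * z ^ n) = z ^ Suc n / of_nat (Suc n)" for n
      by (simp add: diffs_def c_def power2_eq_square del: of_nat_Suc)
    have "summable (\<lambda>n. diffs c n * z ^ n)"
      by (rule termdiff_converges [of z 1]) (use z c in \<open>auto simp: sums_iff\<close>)
    from suminf_mult [OF this, of z] show ?thesis
      using s unfolding eq by (simp add: sums_iff)
  qed
  ultimately show ?thesis by (rule that)
qed

section \<open>Euler-Maclaurin summation of Ln (1 - w exp (-u)) in a sector\<close>

text \<open>A value on the slit would need |w exp (-u)| \<ge> 1, hence Re u = 0. The sector meets
  the imaginary axis only in 0, and \<open>w \<noteq> 1\<close> excludes that point. So the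
  principal logarithm is holomorphic at every point that the summation visits.\<close>

lemma one_minus_exp_nonpos:
  assumes w: "norm w = 1" "w \<noteq> 1" and u: "\<bar>Im u\<bar> \<le> Re u"
  shows "1 - w * exp (- u) \<notin> \<real>\<^sub>\<le>\<^sub>0"
proof
  assume *: "1 - w * exp (- u) \<in> \<real>\<^sub>\<le>\<^sub>0"
  then have re: "Re (w * exp (- u)) \<ge> 1" and im: "Im (w * exp (- u)) = 0"
    by (auto simp: complex_nonpos_Reals_iff)
  have n: "norm (w * exp (- u)) = exp (- Re u)"
    using w by (simp add: norm_mult)
  have "1 \<le> exp (- Re u)"
    using re complex_Re_le_cmod [of "w * exp (- u)"] n by linarith
  then have "Re u = 0" "Im u = 0"
    using u by auto
  then have "u = 0"
    by (simp add: complex_eq_iff)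
  then have "Re w \<ge> 1" "Im w = 0"
    using re im by auto
  moreover have "Re w \<le> 1"
    using complex_Re_le_cmod [of w] w by simp
  ultimately show False
    using w by (auto simp: complex_eq_iff)
qed

lemma Ln_one_minus_exp_derivs:
  assumes "1 - w * exp (- u) \<notin> \<real>\<^sub>\<le>\<^sub>0"
  shows "((\<lambda>u. Ln (1 - w * exp (- u))) has_field_derivative (w * exp (- u) / (1 - w * exp (- u)))) (at u)"
    and "((\<lambda>u. w * exp (- u) / (1 - w * exp (- u))) has_field_derivative
            (- (w * exp (- u) / (1 - w * exp (- u)) ^ 2))) (at u)"
proof -
  have nz: "1 - w * exp (- u) \<noteq> 0"
    using assms by auto
  show "((\<lambda>u. Ln (1 - w * exp (- u))) has_field_derivative (w * exp (- u) / (1 - w * exp (- u)))) (at u)"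
    by (rule derivative_eq_intros refl assms)+ (simp add: field_simps)
  show "((\<lambda>u. w * exp (- u) / (1 - w * exp (- u))) has_field_derivative
            (- (w * exp (- u) / (1 - w * exp (- u)) ^ 2))) (at u)"
    by (rule derivative_eq_intros refl nz)+ (use nz in \<open>simp add: field_simps power2_eq_square\<close>)
qed

text \<open>Gives an explicit antiderivative of the summand: the integral in the Euler-Maclaurin
  formula becomes a difference of dilogarithms.\<close>

lemma dilog_exp_has_field_derivative:
  assumes "norm w = 1" "Re u > 0"
  shows "((\<lambda>u. dilog (w * exp (- u))) has_field_derivative Ln (1 - w * exp (- u))) (at u)"
proof -
  have "norm (w * exp (- u)) < 1"
    using assms by (simp add: norm_mult)
  then obtain D where D: "(dilog has_field_derivative D) (at (w * exp (- u)))"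
    and eq: "(w * exp (- u)) * D = - Ln (1 - w * exp (- u))"
    by (rule dilog_has_field_derivative)
  have "((\<lambda>u. w * exp (- u)) has_field_derivative - (w * exp (- u))) (at u)"
    by (auto intro!: derivative_eq_intros)
  from DERIV_chain2 [OF D this] show ?thesis
    using eq by (simp add: mult_ac)
qed

text \<open>The bounded quantity is, up to sign, the second derivative of Ln (1 - w exp (-u)). For
  Re u \<le> 1 the denominator has a positive minimum by compactness; beyond that |w exp (-u)| \<le>
  1/2. The factor exp (-Re u) makes the step errors summable as a geometric series.\<close>

lemma sector_bound:
  assumes w: "norm w = 1" "w \<noteq> 1"
  obtains C where "C > 0"
    "\<And>u. \<bar>Im u\<bar> \<le> Re u \<Longrightarrow> norm (w * exp (- u) / (1 - w * exp (- u)) ^ 2) \<le> C * exp (- Re u)"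
proof -
  define K where "K = {u. \<bar>Im u\<bar> \<le> Re u \<and> Re u \<le> 1}"
  have "closed K"
    unfolding K_def
    by (intro closed_Collect_conj closed_Collect_le continuous_intros)
  moreover have "bounded K"
  proof (rule boundedI)
    show "norm u \<le> 2" if "u \<in> K" for u
      using that cmod_le [of u] by (auto simp: K_def)
  qed
  ultimately have "compact K"
    by (simp add: compact_eq_bounded_closed)
  moreover have "0 \<in> K"
    by (simp add: K_def)
  moreover have "continuous_on K (\<lambda>u. norm (1 - w * exp (- u)))"
    by (intro continuous_intros)
  ultimately obtain v where v: "v \<in> K"
    and min: "\<And>u. u \<in> K \<Longrightarrow> norm (1 - w * exp (- v)) \<le> norm (1 - w * exp (- u))"
    using continuous_attains_inf [of K] by blast
  define c where "c = min (1/2) (norm (1 - w * exp (- v)))"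
  have c: "c > 0"
    using one_minus_exp_nonpos [OF w, of v] v by (auto simp: c_def K_def)
  have lower: "c \<le> norm (1 - w * exp (- u))" if u: "\<bar>Im u\<bar> \<le> Re u" for u
  proof (cases "Re u \<le> 1")
    case True
    then show ?thesis
      using min [of u] u by (auto simp: c_def K_def)
  next
    case False
    have "exp (- Re u) \<le> exp (- 1)"
      using False by simp
    also have "\<dots> \<le> 1 / 2"
      using exp_ge_add_one_self [of 1] by (simp add: exp_minus field_simps)
    finally have "1 - norm (w * exp (- u)) \<ge> 1 / 2"
      using w by (simp add: norm_mult)
    then show ?thesis
      using norm_triangle_ineq2 [of 1 "w * exp (- u)"] by (simp add: c_def)
  qed
  show ?thesis
  proof (rule that [of "1 / c\<^sup>2"])
    fix u assume u: "\<bar>Im u\<bar> \<le> Re u"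
    have "c\<^sup>2 \<le> (norm (1 - w * exp (- u)))\<^sup>2"
      using lower [OF u] c by (intro power_mono) auto
    then have "exp (- Re u) / (norm (1 - w * exp (- u)))\<^sup>2 \<le> exp (- Re u) / c\<^sup>2"
      using c by (intro divide_left_mono mult_pos_pos)
        (use lower [OF u] in \<open>auto simp: zero_less_power2\<close>)
    then show "norm (w * exp (- u) / (1 - w * exp (- u)) ^ 2) \<le> 1 / c\<^sup>2 * exp (- Re u)"
      using w by (simp add: norm_divide norm_mult norm_power)
  qed (use c in auto)
qed

text \<open>Expanding around \<open>a\<close>, the terms \<open>g a * h\<close> cancel, and so do
  those in g'(a) h^2, with coefficients \<alpha> - 1/2 + (1/2 - \<alpha>) = 0. Only Taylor
  remainders survive: B |h|^3 times 1 (the sample), 1/2 (the integral) and at most 1/2 (the end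
  point correction). Positive real part on the segment keeps \<open>w * exp (- u)\<close> inside the
  open disc.\<close>

lemma Euler_Maclaurin_step_interior:
  fixes w a h :: complex and \<alpha> B :: real
  defines "g \<equiv> \<lambda>u. Ln (1 - w * exp (- u))" and "H \<equiv> \<lambda>u. dilog (w * exp (- u))"
  assumes w: "norm w = 1" and \<alpha>: "0 \<le> \<alpha>" "\<alpha> \<le> 1"
    and pos: "\<And>u. u \<in> closed_segment a (a + h) \<Longrightarrow> Re u > 0"
    and slit: "\<And>u. u \<in> closed_segment a (a + h) \<Longrightarrow> 1 - w * exp (- u) \<notin> \<real>\<^sub>\<le>\<^sub>0"
    and B: "\<And>u. u \<in> closed_segment a (a + h) \<Longrightarrow>
      norm (w * exp (- u) / (1 - w * exp (- u)) ^ 2) \<le> B"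
  shows "norm (h * g (a + of_real \<alpha> * h) - (H (a + h) - H a)
           + of_real (1/2 - \<alpha>) * h * (g (a + h) - g a)) \<le> 2 * B * norm h ^ 3"
proof -
  let ?S = "closed_segment a (a + h)"
  define g1 where "g1 = (\<lambda>u. w * exp (- u) / (1 - w * exp (- u)))"
  define g2 where "g2 = (\<lambda>u. - (w * exp (- u) / (1 - w * exp (- u)) ^ 2))"
  have in_S: "a \<in> ?S" "a + h \<in> ?S" "a + of_real \<alpha> * h \<in> ?S"
    using \<alpha> by (auto simp: in_segment scaleR_conv_of_real algebra_simps intro!: exI [of _ \<alpha>])
  have dH: "(H has_field_derivative g u) (at u within ?S)" if "u \<in> ?S" for u
    unfolding g_def H_def
    by (rule has_field_derivative_at_within [OF dilog_exp_has_field_derivative [OF w pos [OF that]]])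
  have dg: "(g has_field_derivative g1 u) (at u within ?S)"
    "(g1 has_field_derivative g2 u) (at u within ?S)" if "u \<in> ?S" for u
    unfolding g_def g1_def g2_def
    by (rule has_field_derivative_at_within [OF Ln_one_minus_exp_derivs(1) [OF slit [OF that]]]
        has_field_derivative_at_within [OF Ln_one_minus_exp_derivs(2) [OF slit [OF that]]])+
  have B': "norm (g2 u) \<le> B" if "u \<in> ?S" for u
    using B [OF that] by (simp add: g2_def norm_divide norm_mult norm_power)
  have B0: "B \<ge> 0"
    using B' [OF in_S(1)] norm_ge_zero order_trans by blast
  define e1 where "e1 = H (a + h) - (H a + g a * h + g1 a * h\<^sup>2 / 2)"
  define e2 where "e2 = (\<lambda>z. g z - (g a + g1 a * (z - a)))"
  have e1: "norm e1 \<le> B * norm h ^ 3 / 2"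
  proof -
    define F where "F = (\<lambda>i::nat. if i = 0 then H else if i = 1 then g else if i = 2 then g1 else g2)"
    have "norm (F 0 (a + h) - (\<Sum>i\<le>2. F i a * (a + h - a) ^ i / fact i)) \<le>
            B * norm (a + h - a) ^ Suc 2 / fact 2"
      by (rule complex_Taylor [of ?S])
        (use dH dg B' in_S in \<open>auto simp: F_def le_Suc_eq numeral_2_eq_2\<close>)
    then show ?thesis
      by (simp add: F_def e1_def numeral_2_eq_2 numeral_3_eq_3 add_ac)
  qed
  have e2: "norm (e2 z) \<le> B * norm h ^ 2" if "z \<in> ?S" for z
  proof -
    define F where "F = (\<lambda>i::nat. if i = 0 then g else if i = 1 then g1 else g2)"
    have "norm (F 0 z - (\<Sum>i\<le>1. F i a * (z - a) ^ i / fact i)) \<le> B * norm (z - a) ^ Suc 1 / fact 1"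
      by (rule complex_Taylor [of ?S])
        (use dg B' in_S that in \<open>auto simp: F_def le_Suc_eq numeral_2_eq_2\<close>)
    also have "\<dots> \<le> B * norm h ^ 2"
      using segment_bound1 [OF that] B0 by (auto intro!: mult_left_mono power_mono simp: power2_eq_square mult_mono)
    finally show ?thesis
      by (simp add: F_def e2_def)
  qed
  have "h * g (a + of_real \<alpha> * h) - (H (a + h) - H a) + of_real (1/2 - \<alpha>) * h * (g (a + h) - g a)
      = h * e2 (a + of_real \<alpha> * h) - e1 + of_real (1/2 - \<alpha>) * h * e2 (a + h)"
    unfolding e1_def e2_def by (simp add: field_simps power2_eq_square)
  also have "norm \<dots> \<le> norm h * (B * norm h ^ 2) + B * norm h ^ 3 / 2 + 1 / 2 * norm h * (B * norm h ^ 2)"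
  proof (intro order_trans [OF norm_triangle_ineq] order_trans [OF norm_triangle_ineq4] add_mono)
    show "norm (h * e2 (a + of_real \<alpha> * h)) \<le> norm h * (B * norm h ^ 2)"
      using e2 [OF in_S(3)] by (simp add: norm_mult mult_left_mono)
    show "norm (of_real (1/2 - \<alpha>) * h * e2 (a + h)) \<le> 1 / 2 * norm h * (B * norm h ^ 2)"
      unfolding norm_mult norm_of_real
      using \<alpha> e2 [OF in_S(2)] B0 by (intro mult_mono) (auto simp: abs_if)
  qed (rule e1)
  also have "\<dots> = 2 * B * norm h ^ 3"
    by (simp add: power2_eq_square power3_eq_cube field_simps)
  finally show ?thesis .
qed

text \<open>The first step has \<open>a = 0\<close>, on the boundary of the region where
  \<open>H\<close> is known to be differentiable. The interior version is applied at
  \<open>a + s h\<close> with s > 0, with a bound independent of s, and continuity of both sides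
  lets s tend to 0.\<close>

lemma Euler_Maclaurin_step:
  fixes w a h :: complex and \<alpha> C :: real
  defines "g \<equiv> \<lambda>u. Ln (1 - w * exp (- u))" and "H \<equiv> \<lambda>u. dilog (w * exp (- u))"
  assumes w: "norm w = 1" "w \<noteq> 1" and \<alpha>: "0 \<le> \<alpha>" "\<alpha> \<le> 1" and C: "C > 0"
    and bound: "\<And>u. \<bar>Im u\<bar> \<le> Re u \<Longrightarrow>
      norm (w * exp (- u) / (1 - w * exp (- u)) ^ 2) \<le> C * exp (- Re u)"
    and a: "\<bar>Im a\<bar> \<le> Re a" and h: "Re h > 0" "\<bar>Im h\<bar> \<le> Re h"
  shows "norm (h * g (a + of_real \<alpha> * h) - (H (a + h) - H a)
           + of_real (1/2 - \<alpha>) * h * (g (a + h) - g a)) \<le> 2 * (C * exp (- Re a)) * norm h ^ 3"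
proof -
  define E where "E = (\<lambda>a. norm (h * g (a + of_real \<alpha> * h) - (H (a + h) - H a)
           + of_real (1/2 - \<alpha>) * h * (g (a + h) - g a)))"
  have sector: "\<bar>Im (a + of_real s * h)\<bar> \<le> Re (a + of_real s * h)" if "s \<ge> 0" for s
    using abs_triangle_ineq [of "Im a" "s * Im h"] a mult_left_mono [OF h(2) that] that
    by (simp add: abs_mult)
  have "E (a + of_real s * h) \<le> 2 * (C * exp (- Re a)) * norm h ^ 3" if s: "s > 0" for s
    unfolding E_def g_def H_def
  proof (rule Euler_Maclaurin_step_interior [OF w(1) \<alpha>])
    fix u assume "u \<in> closed_segment (a + of_real s * h) (a + of_real s * h + h)"
    then obtain x where x: "x \<ge> 0" and u: "u = a + of_real (s + x) * h"
      by (auto simp: in_segment scaleR_conv_of_real algebra_simps)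
    show pos: "Re u > 0"
      using a h s x by (simp add: u add_nonneg_pos)
    have sec: "\<bar>Im u\<bar> \<le> Re u"
      unfolding u using s x by (intro sector) auto
    show "1 - w * exp (- u) \<notin> \<real>\<^sub>\<le>\<^sub>0"
      by (rule one_minus_exp_nonpos [OF w sec])
    have "exp (- Re u) \<le> exp (- Re a)"
      using s x h by (simp add: u)
    then show "norm (w * exp (- u) / (1 - w * exp (- u)) ^ 2) \<le> C * exp (- Re a)"
      using bound [OF sec] C by (meson mult_left_mono less_imp_le order_trans)
  qed
  moreover have "continuous_on (closure {0<..}) (\<lambda>s. E (a + of_real s * h))"
  proof -
    have H: "continuous_on {0..} (\<lambda>s. H (f s))"
      if f: "continuous_on {0..} f" and "\<And>s. s \<ge> 0 \<Longrightarrow> Re (f s) \<ge> 0" for f :: "real \<Rightarrow> complex"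
      unfolding H_def
    proof (rule continuous_on_compose2 [OF continuous_on_dilog])
      show "continuous_on {0..} (\<lambda>s. w * exp (- f s))"
        by (intro continuous_intros f)
      show "(\<lambda>s. w * exp (- f s)) ` {0..} \<subseteq> cball 0 1"
      proof (rule image_subsetI)
        fix s :: real assume "s \<in> {0..}"
        then show "w * exp (- f s) \<in> cball 0 1"
          using that(2) [of s] w(1) by (simp add: norm_mult)
      qed
    qed
    have g: "continuous_on {0..} (\<lambda>s. g (f s))"
      if f: "continuous_on {0..} f" and sec: "\<And>s. s \<ge> 0 \<Longrightarrow> \<bar>Im (f s)\<bar> \<le> Re (f s)"
      for f :: "real \<Rightarrow> complex"
      unfolding g_def
    proof (rule continuous_on_Ln')
      show "continuous_on {0..} (\<lambda>s. 1 - w * exp (- f s))"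
        by (intro continuous_intros f)
      show "1 - w * exp (- f s) \<notin> \<real>\<^sub>\<le>\<^sub>0" if "s \<in> {0..}" for s
        using one_minus_exp_nonpos [OF w sec] that by simp
    qed
    have sec: "\<bar>Im (a + of_real s * h + of_real x * h)\<bar> \<le> Re (a + of_real s * h + of_real x * h)"
      if "s \<ge> 0" "x \<ge> 0" for s x
    proof -
      have "a + of_real s * h + of_real x * h = a + of_real (s + x) * h"
        by (simp add: algebra_simps)
      then show ?thesis
        using sector [of "s + x"] that by (simp only:)
    qed
    have cont: "continuous_on {0..} (\<lambda>s. a + of_real s * h + of_real x * h)" for x
      by (intro continuous_intros)
    have Hx: "continuous_on {0..} (\<lambda>s. H (a + of_real s * h + of_real x * h))" if "x \<ge> 0" for x
    proof (rule H [OF cont])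
      show "0 \<le> Re (a + of_real s * h + of_real x * h)" if "s \<ge> 0" for s
        using sec [OF that \<open>x \<ge> 0\<close>] by linarith
    qed
    have gx: "continuous_on {0..} (\<lambda>s. g (a + of_real s * h + of_real x * h))" if "x \<ge> 0" for x
      by (rule g [OF cont sec [OF _ that]])
    show ?thesis
      unfolding E_def closure_greaterThan
      using Hx [of 0] Hx [of 1] gx [of 0] gx [of 1] gx [OF \<alpha>(1)]
      by (intro continuous_on_norm continuous_on_add continuous_on_diff continuous_on_mult
          continuous_on_const) simp_all
  qed
  ultimately have "E (a + of_real 0 * h) \<le> 2 * (C * exp (- Re a)) * norm h ^ 3"
    by (intro continuous_le_on_closure [of "{0<..}" "\<lambda>s. E (a + of_real s * h)" 0]) auto
  then show ?thesis
    by (simp add: E_def)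
qed

text \<open>Summing the steps along \<open>a = k h\<close>, the differences of \<open>H\<close> and
  of \<open>g\<close> telescope to -dilog w and -Ln (1 - w). Division by \<open>h\<close> gives the
  two explicit terms, and the step errors, a geometric series, leave O(h).\<close>

theorem log_qpochhammer_asymptotics:
  fixes w :: complex and \<alpha> :: real
  assumes w: "norm w = 1" "w \<noteq> 1" and \<alpha>: "0 \<le> \<alpha>" "\<alpha> \<le> 1"
  obtains C where "C > 0"
    "\<And>h. \<lbrakk>0 < Re h; Re h \<le> 1; \<bar>Im h\<bar> \<le> Re h\<rbrakk> \<Longrightarrow>
       \<exists>s. (\<lambda>k. Ln (1 - w * exp (- (of_real (real k + \<alpha>) * h)))) sums s \<and>
         norm (s - (- dilog w / h + of_real (1/2 - \<alpha>) * Ln (1 - w))) \<le> C * norm h"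
proof -
  obtain C where C: "C > 0" and bound: "\<And>u. \<bar>Im u\<bar> \<le> Re u \<Longrightarrow>
      norm (w * exp (- u) / (1 - w * exp (- u)) ^ 2) \<le> C * exp (- Re u)"
    using sector_bound [OF w] by blast
  define g where "g = (\<lambda>u. Ln (1 - w * exp (- u)))"
  define H where "H = (\<lambda>u. dilog (w * exp (- u)))"
  show ?thesis
  proof (rule that [of "8 * C"])
    fix h :: complex assume h: "0 < Re h" "Re h \<le> 1" "\<bar>Im h\<bar> \<le> Re h"
    have h0: "h \<noteq> 0" using h by auto
    define a where "a = (\<lambda>k. of_nat k * h)"
    define d where "d = (\<lambda>k. h * g (a k + of_real \<alpha> * h) - (H (a (Suc k)) - H (a k))
           + of_real (1/2 - \<alpha>) * h * (g (a (Suc k)) - g (a k)))"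
    define \<rho> where "\<rho> = exp (- Re h)"
    have \<rho>: "0 < \<rho>" "\<rho> < 1" using h by (auto simp: \<rho>_def)
    have a_Suc: "a (Suc k) = a k + h" for k
      by (simp add: a_def algebra_simps)
    have exp_a: "exp (- Re (a k)) = \<rho> ^ k" for k
      by (simp add: a_def \<rho>_def exp_of_nat_mult [symmetric])
    have d: "norm (d k) \<le> (2 * C * norm h ^ 3) * \<rho> ^ k" for k
    proof -
      have "\<bar>Im (a k)\<bar> \<le> Re (a k)"
        using h by (simp add: a_def abs_mult mult_left_mono)
      from Euler_Maclaurin_step [OF w \<alpha> C bound this h(1,3)] show ?thesis
        by (simp add: d_def g_def H_def a_Suc exp_a mult_ac)
    qed
    have geo: "summable (\<lambda>k. (2 * C * norm h ^ 3) * \<rho> ^ k)"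
      using \<rho> by (intro summable_mult summable_geometric) auto
    have sd: "summable d"
      by (rule summable_comparison_test' [OF geo, of 0]) (use d in auto)
    have "norm (suminf d) \<le> (\<Sum>k. (2 * C * norm h ^ 3) * \<rho> ^ k)"
      by (rule norm_suminf_le [OF d geo])
    also have "\<dots> = 2 * C * norm h ^ 3 / (1 - \<rho>)"
      using \<rho> by (subst suminf_mult) (auto intro: summable_geometric simp: suminf_geometric)
    also have "\<dots> \<le> 8 * C * norm h ^ 2"
    proof -
      \<comment> \<open>With |h| \<le> 2 Re h in the sector this yields 1 - \<rho> \<ge> |h|/4, so
        one power of |h| is lost and 2 C becomes 8 C.\<close>
      have "\<rho> \<le> 1 - Re h / 2"
      proof -
        have "(1 + Re h) * \<rho> \<le> 1"
          using mult_right_mono [OF exp_ge_add_one_self [of "Re h"], of \<rho>] \<rho>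
          by (simp add: \<rho>_def exp_minus)
        moreover have "(1 + Re h) * (1 - Re h / 2) \<ge> 1"
          using mult_left_mono [of "Re h" 1 "Re h"] h by (simp add: algebra_simps)
        ultimately have "(1 + Re h) * \<rho> \<le> (1 + Re h) * (1 - Re h / 2)"
          by linarith
        then show ?thesis using h by (simp add: mult_le_cancel_left)
      qed
      moreover have "norm h \<le> 2 * Re h"
        using cmod_le [of h] h by simp
      ultimately have "norm h / 4 \<le> 1 - \<rho>" by simp
      then have "2 * C * norm h ^ 3 / (1 - \<rho>) \<le> 2 * C * norm h ^ 3 / (norm h / 4)"
        using C \<rho> h0 by (intro divide_left_mono) auto
      also have "\<dots> = 8 * C * norm h ^ 2"
        using h0 by (simp add: power3_eq_cube power2_eq_square)
      finally show ?thesis .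
    qed
    finally have D: "norm (suminf d) \<le> 8 * C * norm h ^ 2" .
    have lim0: "(\<lambda>k. w * exp (- a k)) \<longlonglongrightarrow> 0"
    proof (rule Lim_null_comparison)
      show "\<forall>\<^sub>F k in sequentially. norm (w * exp (- a k)) \<le> \<rho> ^ k"
        using w by (simp add: norm_mult exp_a)
      show "(\<lambda>k. \<rho> ^ k) \<longlonglongrightarrow> 0"
        using \<rho> by (intro LIMSEQ_realpow_zero) auto
    qed
    have "isCont dilog 0"
      using continuous_on_dilog by (rule continuous_on_interior) auto
    from isCont_tendsto_compose [OF this lim0] have "(\<lambda>k. H (a k)) \<longlonglongrightarrow> 0"
      by (simp add: H_def)
    from telescope_sums [OF this]
    have sH: "(\<lambda>k. H (a (Suc k)) - H (a k)) sums (0 - dilog w)"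
      by (simp add: H_def a_def)
    have "isCont (\<lambda>z. Ln (1 - z)) 0"
      by (intro continuous_intros) auto
    from isCont_tendsto_compose [OF this lim0] have "(\<lambda>k. g (a k)) \<longlonglongrightarrow> 0"
      by (simp add: g_def)
    from telescope_sums [OF this]
    have sg: "(\<lambda>k. g (a (Suc k)) - g (a k)) sums (0 - Ln (1 - w))"
      by (simp add: g_def a_def)
    define s where "s = (suminf d + (0 - dilog w) - of_real (1/2 - \<alpha>) * h * (0 - Ln (1 - w))) / h"
    have "(\<lambda>k. (d k + (H (a (Suc k)) - H (a k)) - of_real (1/2 - \<alpha>) * h * (g (a (Suc k)) - g (a k))) / h)
            sums s"
      unfolding s_def by (intro sums_divide sums_diff sums_add sums_mult summable_sums sd sH sg)
    moreover have "(d k + (H (a (Suc k)) - H (a k)) - of_real (1/2 - \<alpha>) * h * (g (a (Suc k)) - g (a k))) / h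
        = Ln (1 - w * exp (- (of_real (real k + \<alpha>) * h)))" for k
      using h0 by (simp add: d_def g_def a_def algebra_simps)
    ultimately have s: "(\<lambda>k. Ln (1 - w * exp (- (of_real (real k + \<alpha>) * h)))) sums s"
      by simp
    have "s - (- dilog w / h + of_real (1/2 - \<alpha>) * Ln (1 - w)) = suminf d / h"
      using h0 by (simp add: s_def field_simps)
    also have "norm \<dots> \<le> 8 * C * norm h ^ 2 / norm h"
      unfolding norm_divide by (rule divide_right_mono [OF D]) auto
    also have "\<dots> = 8 * C * norm h"
      using h0 by (simp add: power2_eq_square)
    finally show "\<exists>s. (\<lambda>k. Ln (1 - w * exp (- (of_real (real k + \<alpha>) * h)))) sums s \<and>
         norm (s - (- dilog w / h + of_real (1/2 - \<alpha>) * Ln (1 - w))) \<le> 8 * C * norm h"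
      using s by blast
  qed (use C in auto)
qed

section \<open>Roots of unity and sums of dilogarithms over them\<close>

definition unity_root :: "nat \<Rightarrow> nat \<Rightarrow> complex" where
  "unity_root p a = cis (2 * pi * real a / real p)"

lemma norm_unity_root [simp]: "norm (unity_root p a) = 1"
  by (simp add: unity_root_def)

lemma unity_root_power: "unity_root p a ^ m = unity_root p (a * m)"
  by (simp add: unity_root_def Complex.DeMoivre mult_ac)

lemma unity_root_eq_1_iff:
  assumes "p > 0"
  shows "unity_root p m = 1 \<longleftrightarrow> p dvd m"
proof -
  have "unity_root p m = exp (2 * of_real pi * \<i> * of_nat m / of_nat p)"
    by (simp add: unity_root_def cis_conv_exp mult_ac)
  then show ?thesis
    using complex_root_unity_eq_1 [of p m] assms by simp
qed

lemma unity_root_power_eq_1 [simp]: "p > 0 \<Longrightarrow> unity_root p a ^ p = 1"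
  by (simp add: unity_root_power unity_root_eq_1_iff)

lemma sum_unity_root_powers:
  assumes p: "p > 0" and "coprime a p"
  shows "(\<Sum>r<p. (unity_root p a ^ r) ^ m) = (if p dvd m then of_nat p else 0)"
proof -
  have "(\<Sum>r<p. (unity_root p a ^ r) ^ m) = (\<Sum>r<p. (unity_root p (a * m)) ^ r)"
    by (simp add: unity_root_power mult_ac)
  moreover have "p dvd a * m \<longleftrightarrow> p dvd m"
    using assms by (simp add: coprime_commute coprime_dvd_mult_right_iff)
  moreover have "(\<Sum>r<p. (unity_root p (a * m)) ^ r) = 0" if "unity_root p (a * m) \<noteq> 1"
    using geometric_sum [OF that, of p] p by simp
  ultimately show ?thesis
    using unity_root_eq_1_iff [OF p, of "a * m"] by (cases "p dvd m") auto
qed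

text \<open>Orthogonality keeps only the exponents m = p j of the dilogarithm series, each with
  weight p, and p / (p j)^2 sums to \<zeta>(2) / p.\<close>

lemma sum_dilog_unity_roots:
  assumes p: "p > 0" and "coprime a p"
  shows "(\<Sum>r<p. dilog (unity_root p a ^ r)) = of_real (pi\<^sup>2 / 6 / p)"
proof -
  define f :: "nat \<Rightarrow> complex" where
    "f = (\<lambda>n. (if p dvd Suc n then of_nat p else 0) / of_nat (Suc n) ^ 2)"
  have "(\<lambda>n. \<Sum>r<p. (unity_root p a ^ r) ^ Suc n / of_nat (Suc n) ^ 2) sums
          (\<Sum>r<p. dilog (unity_root p a ^ r))"
    by (intro sums_sum dilog_sums) (simp add: norm_power)
  also have "(\<lambda>n. \<Sum>r<p. (unity_root p a ^ r) ^ Suc n / of_nat (Suc n) ^ 2) = f"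
    unfolding f_def sum_divide_distrib [symmetric] sum_unity_root_powers [OF assms] by simp
  finally have 1: "f sums (\<Sum>r<p. dilog (unity_root p a ^ r))" .
  define g where "g = (\<lambda>j. p * Suc j - 1)"
  have Suc_g: "Suc (g j) = p * Suc j" for j
    using p by (simp add: g_def)
  have "strict_mono g"
  proof (rule strict_monoI_Suc)
    fix j
    have "Suc (g j) < Suc (g (Suc j))"
      unfolding Suc_g using p by simp
    then show "g j < g (Suc j)" by simp
  qed
  moreover have "f n = 0" if "n \<notin> range g" for n
  proof -
    have "\<not> p dvd Suc n"
    proof
      assume "p dvd Suc n"
      then obtain k where k: "Suc n = p * k" ..
      then obtain j where "k = Suc j" by (cases k) auto
      with k Suc_g have "n = g j" by (metis Suc_inject)
      with that show False by auto
    qed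
    then show ?thesis by (simp add: f_def)
  qed
  ultimately have "(\<lambda>j. f (g j)) sums (\<Sum>r<p. dilog (unity_root p a ^ r))"
    using 1 sums_mono_reindex [of g f] by blast
  moreover have "f (g j) = of_real (1 / real (j + 1) ^ 2 / p)" for j
    using p unfolding f_def Suc_g by (simp add: power2_eq_square del: of_nat_Suc mult_Suc_right)
  moreover have "(\<lambda>j. of_real (1 / real (j + 1) ^ 2 / p) :: complex) sums of_real (pi\<^sup>2 / 6 / p)"
    by (intro sums_of_real sums_divide) (use inverse_squares_sums in \<open>simp add: add_ac\<close>)
  ultimately show ?thesis
    using sums_unique2 by auto
qed

lemma dilog_1: "dilog 1 = of_real (pi\<^sup>2 / 6)"
  using sum_dilog_unity_roots [of 1 0] by simp

lemma sum_dilog_primitive_powers: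
  assumes p: "p > 0" and "coprime a p"
  shows "(\<Sum>r=1..<p. dilog (unity_root p a ^ r)) = of_real (pi\<^sup>2 / 6 * (1 / p - 1))"
proof -
  have "(\<Sum>r<p. dilog (unity_root p a ^ r)) = dilog 1 + (\<Sum>r=1..<p. dilog (unity_root p a ^ r))"
    using p by (simp add: lessThan_atLeast0 sum.atLeast_Suc_lessThan)
  then show ?thesis
    unfolding sum_dilog_unity_roots [OF assms] dilog_1 by (simp add: right_diff_distrib eq_diff_eq add.commute)
qed

section \<open>The quotient of products near a root of unity\<close>

lemma euler_prod_LIMSEQ:
  assumes "norm q < 1"
  shows "(\<lambda>N. \<Prod>n<N. 1 - q ^ Suc n) \<longlonglongrightarrow> euler_prod q"
  using tendsto_uniform_limitI [OF euler_prod_uniform_limit [OF assms], of q] by simp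

text \<open>The factors with p dividing the exponent cancel against
  \<open>euler_prod (q ^ p)\<close>. The others are sorted by residue: for exponent k p + r the
  power of \<open>z\<close> is \<open>z ^ r\<close>, and (k p + r) t = (k + r/p) (p t), which is the
  shape of the logarithmic sums with step h = p t and offset \<alpha> = r/p.\<close>

lemma euler_prod_div_eq_exp:
  fixes q z t :: complex
  assumes p: "p > 0" and z: "norm z = 1" "z ^ p = 1" and t: "Re t > 0" and q: "q = z * exp (- t)"
    and s: "\<And>r. r \<in> {1..<p} \<Longrightarrow>
      (\<lambda>k. Ln (1 - z ^ r * exp (- (of_real (real k + real r / real p) * (of_nat p * t))))) sums s r"
  shows "euler_prod q / euler_prod (q ^ p) = exp (\<Sum>r=1..<p. s r)"
proof -
  have nq: "norm q < 1"
    using z t by (simp add: q norm_mult)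
  have nqp: "norm (q ^ p) < 1"
    by (rule norm_power_less_1 [OF nq p])
  have q_pow: "z ^ r * exp (- (of_real (real k + real r / real p) * (of_nat p * t))) = q ^ (k * p + r)"
    for k r
  proof -
    have "q ^ (k * p + r) = z ^ r * exp (of_nat (k * p + r) * - t)"
      unfolding q power_mult_distrib exp_of_nat_mult by (simp add: power_add power_mult z mult.commute [of k])
    also have "of_nat (k * p + r) * - t = - (of_real (real k + real r / real p) * (of_nat p * t))"
      using p by (simp add: field_simps)
    finally show ?thesis by simp
  qed
  have exp_Ln: "exp (Ln (1 - q ^ (k * p + r))) = 1 - q ^ (k * p + r)" if "r \<in> {1..<p}" for k r
    using power_Suc_neq_1 [OF nq, of "k * p + r - 1"] that by (intro exp_Ln) (auto simp del: power_Suc)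
  define R where "R = (\<lambda>N. \<Prod>k<N. \<Prod>r=1..<p. 1 - q ^ (k * p + r))"
  have "(\<lambda>N. exp (\<Sum>r=1..<p. \<Sum>k<N. Ln (1 - q ^ (k * p + r)))) \<longlonglongrightarrow> exp (\<Sum>r=1..<p. s r)"
    using s unfolding q_pow sums_def by (intro tendsto_exp tendsto_sum) auto
  moreover have "exp (\<Sum>r=1..<p. \<Sum>k<N. Ln (1 - q ^ (k * p + r))) = R N" for N
  proof -
    have "(\<Sum>r=1..<p. \<Sum>k<N. Ln (1 - q ^ (k * p + r))) = (\<Sum>k<N. \<Sum>r=1..<p. Ln (1 - q ^ (k * p + r)))"
      by (rule sum.swap)
    also have "exp \<dots> = (\<Prod>k<N. \<Prod>r=1..<p. exp (Ln (1 - q ^ (k * p + r))))"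
      by (simp only: exp_sum finite_atLeastLessThan finite_lessThan)
    also have "\<dots> = R N"
      unfolding R_def by (intro prod.cong refl exp_Ln)
    finally show ?thesis .
  qed
  ultimately have R: "R \<longlonglongrightarrow> exp (\<Sum>r=1..<p. s r)"
    by simp
  \<comment> \<open>Partial products of length \<open>N * p\<close> consist of complete blocks of
    residues; along this subsequence both sides converge.\<close>
  have "(\<Prod>n<N * p. 1 - q ^ Suc n) = R N * (\<Prod>k<N. 1 - (q ^ p) ^ Suc k)" for N
  proof -
    have "(\<Prod>n<N * p. 1 - q ^ Suc n) = (\<Prod>k<N. \<Prod>i\<in>{k * p..<k * p + p}. 1 - q ^ Suc i)"
      by (rule prod.nat_group [symmetric])
    also have "\<dots> = (\<Prod>k<N. (\<Prod>r=1..<p. 1 - q ^ (k * p + r)) * (1 - (q ^ p) ^ Suc k))"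
    proof (rule prod.cong [OF refl])
      fix k
      have "(\<Prod>i\<in>{k * p..<k * p + p}. 1 - q ^ Suc i) = (\<Prod>r\<in>{1..<Suc p}. 1 - q ^ (k * p + r))"
        by (rule prod.reindex_bij_witness [of _ "\<lambda>r. k * p + r - 1" "\<lambda>i. Suc i - k * p"]) auto
      also have "\<dots> = (\<Prod>r=1..<p. 1 - q ^ (k * p + r)) * (1 - q ^ (k * p + p))"
        using p by (simp add: prod.atLeastLessThan_Suc)
      also have "q ^ (k * p + p) = (q ^ p) ^ Suc k"
        by (simp add: power_mult [symmetric] power_add [symmetric] algebra_simps)
      finally show "(\<Prod>i\<in>{k * p..<k * p + p}. 1 - q ^ Suc i) =
          (\<Prod>r=1..<p. 1 - q ^ (k * p + r)) * (1 - (q ^ p) ^ Suc k)" .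
    qed
    finally show ?thesis
      by (simp add: prod.distrib R_def)
  qed
  moreover have "(\<lambda>N. \<Prod>n<N * p. 1 - q ^ Suc n) \<longlonglongrightarrow> euler_prod q"
    using p by (intro filterlim_compose [OF euler_prod_LIMSEQ [OF nq]] filterlim_subseq strict_monoI) auto
  ultimately have "(\<lambda>N. R N * (\<Prod>k<N. 1 - (q ^ p) ^ Suc k)) \<longlonglongrightarrow> euler_prod q"
    by simp
  moreover have "(\<lambda>N. R N * (\<Prod>k<N. 1 - (q ^ p) ^ Suc k)) \<longlonglongrightarrow>
      exp (\<Sum>r=1..<p. s r) * euler_prod (q ^ p)"
    by (intro tendsto_mult R euler_prod_LIMSEQ nqp)
  ultimately have "euler_prod q = exp (\<Sum>r=1..<p. s r) * euler_prod (q ^ p)"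
    by (rule LIMSEQ_unique)
  then show ?thesis
    using euler_prod_nonzero [OF nqp] by simp
qed

text \<open>The part of the logarithmic expansions that does not depend on t: the product of (1 -
  \<zeta>^r)^(e (1/2 - r/p)) over 0 < r < p, with principal powers.\<close>

definition cusp_const :: "nat \<Rightarrow> nat \<Rightarrow> complex" where
  "cusp_const p a = exp (of_nat (eta_exponent p) *
     (\<Sum>r=1..<p. of_real (1/2 - real r / real p) * Ln (1 - unity_root p a ^ r)))"

text \<open>The expansions for the residues 0 < r < p are added. Single dilogarithms have no simple
  value, but their sum is \<zeta>(2) (1/p - 1), whichever primitive root is taken; so all primitive
  cusps have the same exponent and differ only in the constant.\<close>

theorem euler_quot_near_unity_root:
  assumes p: "p \<in> {2, 3, 5}" and a: "coprime a p"
  obtains C where "C > 0"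
    "\<And>t. \<lbrakk>0 < Re t; real p * Re t \<le> 1; \<bar>Im t\<bar> \<le> Re t\<rbrakk> \<Longrightarrow>
      \<exists>\<delta>. norm \<delta> \<le> C * norm t \<and>
        euler_quot p (unity_root p a * exp (- t)) =
          cusp_const p a * exp (of_real ((2 * pi / p)\<^sup>2) / t) * exp \<delta>"
proof -
  let ?z = "unity_root p a"
  have p0: "p > 0" using p by auto
  have nontriv: "?z ^ r \<noteq> 1" if "r \<in> {1..<p}" for r
  proof -
    have "\<not> p dvd a * r"
      using a that by (auto simp: coprime_commute coprime_dvd_mult_right_iff dest: dvd_imp_le)
    then show ?thesis
      using p0 by (simp add: unity_root_power unity_root_eq_1_iff)
  qed
  define E where "E = (\<lambda>r h. - dilog (?z ^ r) / h + of_real (1/2 - real r / real p) * Ln (1 - ?z ^ r))"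
  have "\<exists>C>0. \<forall>h. 0 < Re h \<and> Re h \<le> 1 \<and> \<bar>Im h\<bar> \<le> Re h \<longrightarrow>
       (\<exists>s. (\<lambda>k. Ln (1 - ?z ^ r * exp (- (of_real (real k + real r / real p) * h)))) sums s \<and>
         norm (s - E r h) \<le> C * norm h)" if r: "r \<in> {1..<p}" for r
  proof -
    have "norm (?z ^ r) = 1" "0 \<le> real r / real p" "real r / real p \<le> 1"
      using r by (auto simp: norm_power)
    from log_qpochhammer_asymptotics [OF this(1) nontriv [OF r] this(2,3)] show ?thesis
      unfolding E_def by metis
  qed
  then obtain C where C: "\<And>r. r \<in> {1..<p} \<Longrightarrow> C r > 0"
    and ex: "\<And>r h. \<lbrakk>r \<in> {1..<p}; 0 < Re h; Re h \<le> 1; \<bar>Im h\<bar> \<le> Re h\<rbrakk> \<Longrightarrow>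
       (\<exists>s. (\<lambda>k. Ln (1 - ?z ^ r * exp (- (of_real (real k + real r / real p) * h)))) sums s \<and>
         norm (s - E r h) \<le> C r * norm h)"
    by metis
  define e where "e = eta_exponent p"
  \<comment> \<open>This normalisation turns e \<zeta>(2) (1 - 1/p) / (p t) into (2 \<pi>/p)^2 / t
    for all three levels.\<close>
  have e: "real e * (real p - 1) = 24"
    using p by (auto simp: e_def eta_exponent_def)
  show ?thesis
  proof (rule that [of "real e * (\<Sum>r=1..<p. C r) * p + 1"])
    have "(\<Sum>r=1..<p. C r) \<ge> 0"
      using C by (intro sum_nonneg less_imp_le) auto
    then show "real e * (\<Sum>r=1..<p. C r) * p + 1 > 0"
      by (intro add_nonneg_pos mult_nonneg_nonneg) auto
    fix t :: complex assume t: "0 < Re t" "real p * Re t \<le> 1" "\<bar>Im t\<bar> \<le> Re t"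
    then have t0: "t \<noteq> 0" by auto
    define h where "h = of_nat p * t"
    have h: "0 < Re h" "Re h \<le> 1" "\<bar>Im h\<bar> \<le> Re h"
      using t p0 by (auto simp: h_def abs_mult)
    obtain s where s: "\<And>r. r \<in> {1..<p} \<Longrightarrow>
        (\<lambda>k. Ln (1 - ?z ^ r * exp (- (of_real (real k + real r / real p) * h)))) sums s r"
      and bd: "\<And>r. r \<in> {1..<p} \<Longrightarrow> norm (s r - E r h) \<le> C r * norm h"
      using ex [OF _ h] by metis
    define \<delta> where "\<delta> = of_nat e * (\<Sum>r=1..<p. s r - E r h)"
    have "norm \<delta> \<le> real e * (\<Sum>r=1..<p. C r * norm h)"
      unfolding \<delta>_def norm_mult norm_of_nat by (intro mult_left_mono sum_norm_le bd) auto
    also have "\<dots> = (real e * (\<Sum>r=1..<p. C r) * p) * norm t"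
      by (simp add: h_def norm_mult sum_distrib_right [symmetric])
    also have "\<dots> \<le> (real e * (\<Sum>r=1..<p. C r) * p + 1) * norm t"
      by (simp add: distrib_right)
    finally have "norm \<delta> \<le> (real e * (\<Sum>r=1..<p. C r) * p + 1) * norm t" .
    moreover have "euler_quot p (?z * exp (- t)) =
        cusp_const p a * exp (of_real ((2 * pi / p)\<^sup>2) / t) * exp \<delta>"
    proof -
      have "euler_prod (?z * exp (- t)) / euler_prod ((?z * exp (- t)) ^ p) = exp (\<Sum>r=1..<p. s r)"
        by (rule euler_prod_div_eq_exp [OF p0 _ _ t(1) refl]) (use s p0 in \<open>auto simp: h_def\<close>)
      then have "euler_quot p (?z * exp (- t)) = exp (of_nat e * (\<Sum>r=1..<p. s r))"
        by (simp add: euler_quot_def e_def exp_of_nat_mult)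
      also have "of_nat e * (\<Sum>r=1..<p. s r) = of_nat e * (\<Sum>r=1..<p. E r h) + \<delta>"
        by (simp add: \<delta>_def sum_subtractf algebra_simps)
      also have "(\<Sum>r=1..<p. E r h) = - of_real (pi\<^sup>2 / 6 * (1 / p - 1)) / h +
          (\<Sum>r=1..<p. of_real (1/2 - real r / real p) * Ln (1 - ?z ^ r))"
        unfolding E_def sum.distrib sum_divide_distrib [symmetric] sum_negf
          sum_dilog_primitive_powers [OF p0 a] ..
      also note distrib_left
      also have "of_nat e * (- of_real (pi\<^sup>2 / 6 * (1 / p - 1)) / h) = of_real ((2 * pi / p)\<^sup>2) / t"
      proof -
        have "of_nat e * (- of_real (pi\<^sup>2 / 6 * (1 / p - 1)) / h) =
            of_real (real e * (pi\<^sup>2 / 6 * (1 - 1 / p)) / p) / t"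
        proof -
          have "- of_real (pi\<^sup>2 / 6 * (1 / p - 1)) = (of_real (pi\<^sup>2 / 6 * (1 - 1 / p)) :: complex)"
            by (subst of_real_minus [symmetric], rule arg_cong [where f = of_real])
              (simp only: minus_diff_eq mult_minus_right [symmetric])
          then show ?thesis
            unfolding \<open>- of_real (pi\<^sup>2 / 6 * (1 / p - 1)) = _\<close> by (simp add: h_def)
        qed
        also have "real e * (pi\<^sup>2 / 6 * (1 - 1 / p)) / p = (real e * (real p - 1)) * pi\<^sup>2 / 6 / p\<^sup>2"
        proof -
          have "1 - 1 / real p = (real p - 1) / real p"
            using p0 by (simp add: diff_divide_distrib)
          then show ?thesis
            by (simp add: power2_eq_square mult_ac)
        qed
        also have "\<dots> = (2 * pi / p)\<^sup>2"
          unfolding e by (simp add: power2_eq_square)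
        finally show ?thesis .
      qed
      finally show ?thesis
        by (simp add: exp_add cusp_const_def e_def)
    qed
    ultimately show "\<exists>\<delta>. norm \<delta> \<le> (real e * (\<Sum>r=1..<p. C r) * p + 1) * norm t \<and>
        euler_quot p (?z * exp (- t)) = cusp_const p a * exp (of_real ((2 * pi / p)\<^sup>2) / t) * exp \<delta>"
      by blast
  qed
qed

subsection \<open>Minor arcs\<close>

text \<open>Each -Ln (1 - q^n) is expanded in powers of q^n, and the absolutely convergent double
  series is summed over n first, where it is geometric. Passing to real parts makes the branch of
  the logarithm of the product irrelevant.\<close>

lemma neg_ln_norm_euler_prod_sums:
  assumes q: "norm q < 1"
  shows "(\<lambda>m. Re (q ^ Suc m / (1 - q ^ Suc m)) / real (Suc m)) sums - ln (norm (euler_prod q))"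
proof -
  define r where "r = norm q"
  have r: "0 \<le> r" "r < 1" using q by (auto simp: r_def)
  have q1: "q ^ Suc n \<noteq> 1" "norm (q ^ Suc n) < 1" for n
    using power_Suc_neq_1 [OF q, of n] norm_power_less_1 [OF q, of "Suc n"] by auto
  define f where "f = (\<lambda>(n, m). (q ^ Suc n) ^ Suc m / (of_nat (Suc m) :: complex))"
  \<comment> \<open>From (n + 1)(m + 1) \<ge> n + m: a product of two geometric series as majorant,
    which justifies the exchange of summations.\<close>
  have f_le: "norm (f (n, m)) \<le> r ^ n * r ^ m" for n m
  proof -
    have "norm (f (n, m)) = r ^ (Suc n * Suc m) / real (Suc m)"
      by (simp add: f_def norm_divide norm_power r_def power_mult [symmetric] del: power_Suc of_nat_Suc mult_Suc mult_Suc_right)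
    also have "\<dots> \<le> r ^ (Suc n * Suc m)"
      using r mult_left_mono [of 1 "real (Suc m)" "r ^ (Suc n * Suc m)"] by (simp add: divide_le_eq)
    also have "\<dots> \<le> r ^ (n + m)"
      using r by (intro power_decreasing) auto
    finally show ?thesis
      by (simp add: power_add)
  qed
  have geo: "((\<lambda>m. c * r ^ m) has_sum c / (1 - r)) UNIV" if "c \<ge> 0" for c
  proof -
    have "(\<lambda>m. c * r ^ m) sums (c * (1 / (1 - r)))"
      using r by (intro sums_mult geometric_sums) auto
    then show ?thesis
      using r that by (intro norm_summable_imp_has_sum) (auto simp: sums_iff)
  qed
  have "(\<lambda>(n, m). r ^ n * r ^ m) summable_on UNIV \<times> UNIV"
  proof (rule summable_on_SigmaI)
    show "((\<lambda>m. case (n, m) of (n, m) \<Rightarrow> r ^ n * r ^ m) has_sum r ^ n / (1 - r)) UNIV" for n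
      using geo [of "r ^ n"] r by simp
    show "(\<lambda>n. r ^ n / (1 - r)) summable_on UNIV"
      using geo [of "1 / (1 - r)"] r by (auto simp: summable_on_def)
  qed (use r in auto)
  then have "(\<lambda>x. norm (case x of (n, m) \<Rightarrow> r ^ n * r ^ m)) summable_on UNIV \<times> UNIV"
    by (subst summable_on_iff_abs_summable_on_real [symmetric])
  then have "(\<lambda>x. norm (f x)) summable_on UNIV \<times> UNIV"
  proof (rule Infinite_Sum.abs_summable_on_comparison_test)
    show "norm (f x) \<le> norm (case x of (n, m) \<Rightarrow> r ^ n * r ^ m)" for x
      using f_le [of "fst x" "snd x"] r by (cases x) (simp add: abs_mult)
  qed
  then have "f summable_on UNIV \<times> UNIV"
    by (rule Infinite_Sum.abs_summable_summable)
  then obtain S where S: "(f has_sum S) (UNIV \<times> UNIV)"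
    unfolding summable_on_def by blast
  have norm_sum1: "summable (\<lambda>m. norm (f (n, m)))" for n
  proof (rule summable_comparison_test')
    show "summable (\<lambda>m. r ^ n * r ^ m)"
      using r by (intro summable_mult summable_geometric) auto
  qed (use f_le in auto)
  have norm_sum2: "summable (\<lambda>n. norm (f (n, m)))" for m
  proof (rule summable_comparison_test')
    show "summable (\<lambda>n. r ^ n * r ^ m)"
      using r by (intro summable_mult2 summable_geometric) auto
  qed (use f_le in auto)
  have "((\<lambda>m. f (n, m)) has_sum - Ln (1 - q ^ Suc n)) UNIV" for n
  proof (rule norm_summable_imp_has_sum [OF norm_sum1])
    have "(\<lambda>m. - ((q ^ Suc n) ^ m) / of_nat m) sums Ln (1 - q ^ Suc n)"
      using Ln_series' [of "- (q ^ Suc n)"] q1 [of n] by simp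
    then have "(\<lambda>m. - ((q ^ Suc n) ^ Suc m) / of_nat (Suc m)) sums Ln (1 - q ^ Suc n)"
      by (subst sums_Suc_iff) simp
    from sums_minus [OF this] show "(\<lambda>m. f (n, m)) sums - Ln (1 - q ^ Suc n)"
      by (simp add: f_def)
  qed
  from has_sum_imp_sums [OF has_sum_SigmaD [OF S this]]
  have Ln: "(\<lambda>n. - Ln (1 - q ^ Suc n)) sums S" .
  have "((\<lambda>n. f (n, m)) has_sum (q ^ Suc m / (1 - q ^ Suc m)) / of_nat (Suc m)) UNIV" for m
  proof (rule norm_summable_imp_has_sum [OF norm_sum2])
    have "(\<lambda>n. q ^ Suc m * (q ^ Suc m) ^ n / of_nat (Suc m)) sums
        (q ^ Suc m * (1 / (1 - q ^ Suc m)) / of_nat (Suc m))"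
      using q1 [of m] by (intro sums_divide sums_mult geometric_sums)
    moreover have "q ^ Suc m * (q ^ Suc m) ^ n = (q ^ Suc n) ^ Suc m" for n
      by (simp only: power_mult [symmetric] power_add [symmetric]) (simp add: algebra_simps)
    ultimately show "(\<lambda>n. f (n, m)) sums ((q ^ Suc m / (1 - q ^ Suc m)) / of_nat (Suc m))"
      by (simp add: f_def del: power_Suc of_nat_Suc)
  qed
  note inner = this
  have "((\<lambda>(m, n). f (n, m)) has_sum S) (UNIV \<times> UNIV)"
    using S has_sum_swap [where f = f and S = S] by blast
  then have "((\<lambda>m. (q ^ Suc m / (1 - q ^ Suc m)) / of_nat (Suc m)) has_sum S) UNIV"
    by (rule has_sum_SigmaD) (simp only: prod.case, rule inner)
  from sums_Re [OF has_sum_imp_sums [OF this]]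
  have Lambert: "(\<lambda>m. Re (q ^ Suc m / (1 - q ^ Suc m)) / real (Suc m)) sums Re S"
    by (simp only: Re_divide_of_nat)
  have "(\<lambda>N. exp (- Re (\<Sum>n<N. - Ln (1 - q ^ Suc n)))) \<longlonglongrightarrow> exp (- Re S)"
    using Ln unfolding sums_def by (intro tendsto_exp tendsto_minus tendsto_Re)
  moreover have "exp (- Re (\<Sum>n<N. - Ln (1 - q ^ Suc n))) = norm (\<Prod>n<N. 1 - q ^ Suc n)" for N
  proof -
    have "- Re (\<Sum>n<N. - Ln (1 - q ^ Suc n)) = (\<Sum>n<N. Re (Ln (1 - q ^ Suc n)))"
      by (simp only: sum_negf uminus_complex.simps Re_sum minus_minus)
    also have "exp \<dots> = (\<Prod>n<N. exp (Re (Ln (1 - q ^ Suc n))))"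
      by (simp only: exp_sum finite_lessThan)
    also have "\<dots> = (\<Prod>n<N. norm (1 - q ^ Suc n))"
    proof (intro prod.cong refl)
      fix n
      have "1 - q ^ Suc n \<noteq> 0" using q1(1) [of n] by auto
      then show "exp (Re (Ln (1 - q ^ Suc n))) = norm (1 - q ^ Suc n)"
        by (metis exp_Ln norm_exp_eq_Re)
    qed
    finally show ?thesis
      by (simp add: prod_norm)
  qed
  ultimately have "(\<lambda>N. norm (\<Prod>n<N. 1 - q ^ Suc n)) \<longlonglongrightarrow> exp (- Re S)"
    by simp
  moreover have "(\<lambda>N. norm (\<Prod>n<N. 1 - q ^ Suc n)) \<longlonglongrightarrow> norm (euler_prod q)"
    by (intro tendsto_norm euler_prod_LIMSEQ q)
  ultimately have "norm (euler_prod q) = exp (- Re S)"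
    using LIMSEQ_unique by blast
  with Lambert show ?thesis by simp
qed

text \<open>This lower bound stays bounded as z approaches 1, whereas |z / (1 - z)| does not. It
  limits the contribution of any set of Lambert terms to at most -ln (1 - |q|), hence to a power of
  1/t in the quotient.\<close>

lemma Re_geometric_ge:
  fixes z :: complex
  assumes "norm z < 1"
  shows "Re (z / (1 - z)) \<ge> - norm z"
proof -
  define \<rho> x where "\<rho> = norm z" and "x = Re z"
  have \<rho>: "0 \<le> \<rho>" "\<rho> < 1" and x: "\<bar>x\<bar> \<le> \<rho>"
    using assms abs_Re_le_cmod [of z] by (auto simp: \<rho>_def x_def)
  have sq: "\<rho>\<^sup>2 = (Re z)\<^sup>2 + (Im z)\<^sup>2"
    by (simp add: \<rho>_def cmod_power2)
  have d: "(1 - Re z)\<^sup>2 + (Im z)\<^sup>2 = 1 - 2 * x + \<rho>\<^sup>2"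
    unfolding sq x_def by (simp add: power2_eq_square algebra_simps)
  have "z \<noteq> 1" using assms by auto
  then have pos: "1 - 2 * x + \<rho>\<^sup>2 > 0"
    unfolding d [symmetric] by (auto simp: complex_eq_iff sum_power2_gt_zero_iff)
  have "Re (z / (1 - z)) = (x - \<rho>\<^sup>2) / (1 - 2 * x + \<rho>\<^sup>2)"
    unfolding Re_divide d [symmetric] sq x_def by (simp add: power2_eq_square algebra_simps)
  moreover have "- \<rho> * (1 - 2 * x + \<rho>\<^sup>2) \<le> x - \<rho>\<^sup>2"
  proof -
    \<comment> \<open>The difference of the two sides is affine in x, and |x| \<le> \<rho>; the
      expression interpolates between its nonnegative values at x = \<rho> and x = -\<rho>.\<close>
    have "(x + \<rho>) * ((1 - \<rho>) * (2 - \<rho>)) + (\<rho> - x) * (\<rho> * (1 + \<rho>)) \<ge> 0"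
    proof -
      have "0 \<le> x + \<rho>" "0 \<le> \<rho> - x" using x by linarith+
      then show ?thesis
        using \<rho> by (metis add_nonneg_nonneg mult_nonneg_nonneg diff_ge_0_iff_ge less_imp_le
            less_trans one_less_numeral_iff semiring_norm(76) zero_le_one)
    qed
    moreover have "(x + \<rho>) * ((1 - \<rho>) * (2 - \<rho>)) + (\<rho> - x) * (\<rho> * (1 + \<rho>)) =
        2 * (x - \<rho>\<^sup>2 + \<rho> * (1 - 2 * x + \<rho>\<^sup>2))"
      by (simp add: power2_eq_square algebra_simps)
    ultimately show ?thesis by simp
  qed
  ultimately show ?thesis
    using pos by (simp add: \<rho>_def pos_le_divide_eq)
qed

text \<open>\<open>S\<close> is the Lambert series of the denominator. The terms m = p k of the
  numerator's series cancel the fraction 1/p of it; the remaining terms are estimated by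
  \<open>Re_geometric_ge\<close>. The term m = 1 is kept exactly, since it supplies the decay near q
  = 1.\<close>

lemma ln_norm_euler_prod_div_le:
  assumes q: "norm q < 1" and p: "p \<ge> 2"
  obtains S where "(\<lambda>k. Re (q ^ (p * Suc k) / (1 - q ^ (p * Suc k))) / real (Suc k)) sums S"
    "ln (norm (euler_prod q / euler_prod (q ^ p))) \<le>
       (1 - 1 / p) * S - ln (1 - norm q) - (Re (q / (1 - q)) + norm q)"
proof -
  define a where "a = (\<lambda>m. Re (q ^ Suc m / (1 - q ^ Suc m)))"
  define b where "b = (\<lambda>m. (a m + norm q ^ Suc m) / real (Suc m))"
  define S where "S = - ln (norm (euler_prod (q ^ p)))"
  define g where "g = (\<lambda>k. p * Suc k - 1)"
  have Suc_g: "Suc (g k) = p * Suc k" for k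
    using p by (simp add: g_def)
  have nqp: "norm (q ^ p) < 1"
    using q p by (intro norm_power_less_1) auto
  have S: "(\<lambda>k. a (g k) / real (Suc k)) sums S"
    using neg_ln_norm_euler_prod_sums [OF nqp]
    unfolding S_def a_def Suc_g by (simp add: power_mult del: power_Suc mult_Suc_right)
  have geo: "(\<lambda>m. norm q ^ Suc m / real (Suc m)) sums - ln (1 - norm q)"
  proof -
    have "(\<lambda>n. - (norm q ^ n) / real n) sums ln (1 - norm q)"
      using ln_series' [of "- norm q"] q by simp
    then have "(\<lambda>n. - (norm q ^ Suc n) / real (Suc n)) sums ln (1 - norm q)"
      by (subst sums_Suc_iff) simp
    from sums_minus [OF this] show ?thesis by simp
  qed
  have b_sums: "b sums (- ln (norm (euler_prod q)) + - ln (1 - norm q))"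
    unfolding b_def add_divide_distrib a_def
    by (intro sums_add neg_ln_norm_euler_prod_sums q geo)
  have b_nonneg: "b m \<ge> 0" for m
    using Re_geometric_ge [OF norm_power_less_1 [OF q, of "Suc m"]]
    by (simp add: b_def a_def norm_power del: power_Suc)
  \<comment> \<open>The part of the series that is kept: multiples of p without the added |q|^m, and
    the term m = 1 with it. These do not collide because p \<ge> 2.\<close>
  define c where "c = (\<lambda>k. (if k \<in> range g then a k / real (Suc k) else 0) + (if k = 0 then b 0 else 0))"
  have c_sums: "c sums (S / p + b 0)"
    unfolding c_def
  proof (intro sums_add sums_single)
    have "strict_mono g"
    proof (rule strict_monoI_Suc)
      fix k
      have "Suc (g k) < Suc (g (Suc k))"
        unfolding Suc_g using p by simp
      then show "g k < g (Suc k)" by simp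
    qed
    moreover have "(\<lambda>k. a (g k) / real (Suc (g k))) sums (S / p)"
      using sums_divide [OF S, of "real p"] unfolding Suc_g by (simp add: field_simps)
    ultimately show "(\<lambda>k. if k \<in> range g then a k / real (Suc k) else 0) sums (S / p)"
      using sums_mono_reindex [of g "\<lambda>k. if k \<in> range g then a k / real (Suc k) else 0"] by simp
  qed
  have c_le: "c m \<le> b m" for m
  proof (cases "m = 0")
    case True
    have "0 \<notin> range g"
    proof
      assume "0 \<in> range g"
      then obtain k where "0 = g k" by auto
      then have "1 = p * Suc k" using Suc_g [of k] by simp
      then show False using p by simp
    qed
    then show ?thesis using True by (simp add: c_def)
  next
    case False
    then show ?thesis
      using b_nonneg [of m] by (simp add: c_def b_def divide_right_mono)
  qed
  have "S / p + b 0 \<le> - ln (norm (euler_prod q)) + - ln (1 - norm q)"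
    by (rule sums_le [OF c_le c_sums b_sums])
  moreover have "ln (norm (euler_prod q / euler_prod (q ^ p))) = ln (norm (euler_prod q)) + S"
    using euler_prod_nonzero [OF q] euler_prod_nonzero [OF nqp]
    by (simp add: norm_divide ln_div S_def)
  ultimately have "ln (norm (euler_prod q / euler_prod (q ^ p))) \<le> (1 - 1 / p) * S - ln (1 - norm q) - b 0"
    by (simp add: algebra_simps)
  moreover have "(\<lambda>k. Re (q ^ (p * Suc k) / (1 - q ^ (p * Suc k))) / real (Suc k)) sums S"
    using S unfolding a_def Suc_g .
  ultimately show ?thesis
    using that by (simp add: b_def a_def)
qed

section \<open>Savings in the first Lambert term away from the main arcs\<close>

lemma norm_one_minus_exp_squared:
  "(norm (1 - exp (Complex (- s) \<phi>)))\<^sup>2 = (1 - exp (- s))\<^sup>2 + 2 * exp (- s) * (1 - cos \<phi>)"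
proof -
  have "(norm (1 - exp (Complex (- s) \<phi>)))\<^sup>2 = (1 - exp (- s) * cos \<phi>)\<^sup>2 + (exp (- s) * sin \<phi>)\<^sup>2"
    by (simp add: cmod_power2 Re_exp Im_exp)
  also have "\<dots> = (1 - exp (- s))\<^sup>2 + 2 * exp (- s) * (1 - cos \<phi>)"
    unfolding power_mult_distrib sin_squared_eq by (simp add: power2_eq_square algebra_simps)
  finally show ?thesis .
qed

lemma one_minus_cos:
  fixes \<phi> :: real
  shows "1 - cos \<phi> = 2 * (sin (\<phi> / 2))\<^sup>2"
  using cos_double_sin [of "\<phi> / 2"] by simp

lemma exp_div_one_minus_exp_le:
  fixes s :: real
  assumes "s > 0"
  shows "exp (- s) / (1 - exp (- s)) \<le> 1 / s"
proof -
  have "exp (- s) * (1 + s) \<le> exp (- s) * exp s"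
    using exp_ge_add_one_self [of s] by (intro mult_left_mono) auto
  then have "exp (- s) * s \<le> 1 - exp (- s)"
    by (simp add: exp_minus algebra_simps)
  then show ?thesis
    using assms by (simp add: field_simps)
qed

text \<open>A gain of 9/10 over the trivial bound 1/s once the phase is at least s: sin (s/2) \<ge>
  s/4 gives 1 - cos \<phi> \<ge> s^2/8, hence |1 - z|^2 \<ge> (5/4)(\<rho> s)^2, and (10/9)^2 <
  5/4.\<close>

lemma norm_geometric_off_axis_le:
  assumes s: "0 < s" "s \<le> 1" and \<phi>: "s \<le> \<bar>\<phi>\<bar>" "\<bar>\<phi>\<bar> \<le> pi"
  defines "z \<equiv> exp (Complex (- s) \<phi>)"
  shows "norm (z / (1 - z)) \<le> 9 / (10 * s)"
proof -
  define \<rho> where "\<rho> = exp (- s)"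
  have \<rho>: "0 < \<rho>" "\<rho> < 1" using s by (auto simp: \<rho>_def)
  have "\<bar>sin (s / 2) - s / 2\<bar> \<le> (s / 2) ^ 3 / 6"
    using Maclaurin_sin_bound [of "s / 2" 3] s
    by (simp add: numeral_3_eq_3 sin_coeff_def abs_mult power_abs fact_numeral)
  moreover have "(s / 2) ^ 3 \<le> s / 2"
    using power_decreasing [of 1 3 "s / 2"] s by simp
  ultimately have "s / 4 \<le> sin (s / 2)"
    using s by linarith
  then have "(s / 4)\<^sup>2 \<le> (sin (s / 2))\<^sup>2"
    using s by (intro power_mono) auto
  then have "1 - cos s \<ge> s\<^sup>2 / 8"
    by (simp add: one_minus_cos power2_eq_square)
  moreover have "cos \<phi> \<le> cos s"
    using cos_monotone_0_pi_le [of s "\<bar>\<phi>\<bar>"] s \<phi> by simp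
  ultimately have cos: "1 - cos \<phi> \<ge> s\<^sup>2 / 8"
    by linarith
  have "\<rho> * s \<le> 1 - \<rho>"
    using exp_div_one_minus_exp_le [OF s(1)] s \<rho> by (simp add: \<rho>_def field_simps)
  then have "(\<rho> * s)\<^sup>2 \<le> (1 - \<rho>)\<^sup>2"
    using \<rho> s by (intro power_mono) auto
  moreover have "2 * \<rho> * (s\<^sup>2 / 8) \<le> 2 * \<rho> * (1 - cos \<phi>)"
    using cos \<rho> by (intro mult_left_mono) auto
  moreover have "\<rho>\<^sup>2 * s\<^sup>2 \<le> \<rho> * s\<^sup>2"
    using \<rho> by (intro mult_right_mono) (auto simp: power2_eq_square mult_le_one)
  ultimately have "(norm (1 - z))\<^sup>2 \<ge> 5 / 4 * (\<rho> * s)\<^sup>2"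
    unfolding z_def norm_one_minus_exp_squared \<rho>_def [symmetric] by (simp add: power_mult_distrib)
  moreover have "(10 / 9 * (\<rho> * s))\<^sup>2 \<le> 5 / 4 * (\<rho> * s)\<^sup>2"
  proof -
    have "(10 / 9 * x)\<^sup>2 \<le> 5 / 4 * x\<^sup>2" for x :: real
      by (simp add: power2_eq_square)
    then show ?thesis by blast
  qed
  ultimately have "(10 / 9 * (\<rho> * s))\<^sup>2 \<le> (norm (1 - z))\<^sup>2"
    by linarith
  then have le: "10 / 9 * (\<rho> * s) \<le> norm (1 - z)"
    by (rule power2_le_imp_le) auto
  have "norm z = \<rho>"
    by (simp add: z_def \<rho>_def norm_exp_eq_Re)
  moreover have "\<rho> / norm (1 - z) \<le> \<rho> / (10 / 9 * (\<rho> * s))"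
  proof -
    have pos: "0 < 10 / 9 * (\<rho> * s)" using \<rho> s by simp
    show ?thesis
      using le \<rho> less_le_trans [OF pos le] s by (intro divide_left_mono mult_pos_pos) auto
  qed
  moreover have "\<rho> / (10 / 9 * (\<rho> * s)) = 9 / (10 * s)"
    using \<rho> by simp
  ultimately show ?thesis
    unfolding norm_divide by (simp only:)
qed

text \<open>To first order z / (1 - z) is 1 / (s - i \<phi>), with real part s / (s^2 + \<phi>^2)
  \<ge> 1 / (2 s); the constant 1/4 leaves room for the error when s \<le> 1/4.\<close>

lemma Re_geometric_near_1_ge:
  assumes s: "0 < s" "s \<le> 1 / 4" and \<phi>: "\<bar>\<phi>\<bar> \<le> s"
  defines "z \<equiv> exp (Complex (- s) \<phi>)"
  shows "Re (z / (1 - z)) \<ge> 1 / (4 * s)"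
proof -
  define \<rho> where "\<rho> = exp (- s)"
  have \<rho>: "0 < \<rho>" "\<rho> < 1" using s by (auto simp: \<rho>_def)
  have \<rho>_ge: "\<rho> \<ge> 1 - s"
    using exp_ge_add_one_self [of "- s"] by (simp add: \<rho>_def)
  have \<rho>_le: "\<rho> \<le> 1 - 4 / 5 * s"
  proof -
    have "\<rho> * (1 + s) \<le> 1"
      using mult_left_mono [OF exp_ge_add_one_self [of s], of \<rho>] \<rho> by (simp add: \<rho>_def exp_minus)
    moreover have "1 \<le> (1 - 4 / 5 * s) * (1 + s)"
      using mult_left_mono [of s "1/4" s] s by (simp add: algebra_simps)
    ultimately have "\<rho> * (1 + s) \<le> (1 - 4 / 5 * s) * (1 + s)"
      by linarith
    then show ?thesis using s by (simp add: mult_le_cancel_right)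
  qed
  have "\<bar>sin (\<phi> / 2)\<bar> \<le> \<bar>\<phi> / 2\<bar>"
    by (rule abs_sin_x_le_abs_x)
  also have "\<dots> \<le> s / 2" using \<phi> by simp
  finally have "(sin (\<phi> / 2))\<^sup>2 \<le> (s / 2)\<^sup>2"
    using power_mono [of "\<bar>sin (\<phi> / 2)\<bar>" "s / 2" 2] by simp
  then have cos: "1 - cos \<phi> \<le> s\<^sup>2 / 2"
    by (simp add: one_minus_cos power2_eq_square)
  have s2: "s\<^sup>2 \<le> s / 4"
    using mult_left_mono [of s "1/4" s] s by (simp add: power2_eq_square)
  \<comment> \<open>27/40 = 4/5 - 1/8, from 1 - \<rho> \<ge> 4 s / 5 and s^2 / 2 \<le> s /
    8.\<close>
  have num: "27 / 40 * s \<le> cos \<phi> - \<rho>"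
    using cos s2 \<rho>_le by linarith
  have den: "(norm (1 - z))\<^sup>2 \<le> 2 * s\<^sup>2"
  proof -
    have "(1 - \<rho>)\<^sup>2 \<le> s\<^sup>2"
      using \<rho> \<rho>_ge by (intro power_mono) auto
    moreover have "2 * \<rho> * (1 - cos \<phi>) \<le> 2 * 1 * (s\<^sup>2 / 2)"
      using \<rho> cos by (intro mult_mono) auto
    ultimately show ?thesis
      unfolding z_def norm_one_minus_exp_squared \<rho>_def [symmetric] by simp
  qed
  have "Re (z / (1 - z)) = (Re z * (1 - Re z) - (Im z)\<^sup>2) / (norm (1 - z))\<^sup>2"
    unfolding Re_divide cmod_power2 by (simp add: power2_eq_square)
  also have "Re z * (1 - Re z) - (Im z)\<^sup>2 = \<rho> * cos \<phi> * (1 - \<rho> * cos \<phi>) - \<rho>\<^sup>2 * (sin \<phi>)\<^sup>2"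
    by (simp add: z_def Re_exp Im_exp \<rho>_def power_mult_distrib)
  also have "\<dots> = \<rho> * (cos \<phi> - \<rho>)"
    unfolding sin_squared_eq by (simp add: power2_eq_square algebra_simps)
  finally have eq: "Re (z / (1 - z)) = \<rho> * (cos \<phi> - \<rho>) / (norm (1 - z))\<^sup>2" .
  have "norm z = \<rho>"
    by (simp add: z_def \<rho>_def norm_exp_eq_Re)
  then have nz: "z \<noteq> 1"
    using \<rho> by auto
  have "1 / (4 * s) \<le> (3 / 4 * (27 / 40 * s)) / (2 * s\<^sup>2)"
    using s by (simp add: power2_eq_square field_simps)
  also have "\<dots> \<le> \<rho> * (cos \<phi> - \<rho>) / (norm (1 - z))\<^sup>2"
    using \<rho> \<rho>_ge s num den nz by (intro frac_le mult_mono mult_nonneg_nonneg) auto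
  finally show ?thesis
    unfolding eq .
qed

text \<open>Off the main arcs the first term of \<open>S\<close> is smaller than 1 / (s p) by a
  tenth. After the factor e (1 - 1/p) this lowers the exponent by 24 / (10 p^2 s), which is the 12 /
  (5 p^2) of the statement.\<close>

theorem euler_quot_minor_arc_bound:
  assumes p: "p \<in> {2, 3, 5}" and t: "0 < Re t" "Re t \<le> 1 / 5" "\<bar>Im t\<bar> \<le> pi / p"
    and minor: "\<bar>Im t\<bar> \<ge> Re t \<or> p dvd a"
  shows "norm (euler_quot p (unity_root p a * exp (- t))) \<le>
     (2 / Re t) ^ eta_exponent p * exp (((2 * pi / p)\<^sup>2 - 12 / (5 * p\<^sup>2)) / Re t)"
proof -
  define s where "s = Re t"
  define q where "q = unity_root p a * exp (- t)"
  define r where "r = exp (- s)"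
  have p0: "p > 0" "p \<ge> 2" "p \<le> 5" using p by auto
  have s: "0 < s" "s \<le> 1 / 5" using t by (auto simp: s_def)
  have r: "0 < r" "r < 1" using s by (auto simp: r_def)
  have nq: "norm q = r"
    by (simp add: q_def norm_mult r_def s_def)
  have nq1: "norm q < 1" using nq r by simp
  obtain S where S: "(\<lambda>k. Re (q ^ (p * Suc k) / (1 - q ^ (p * Suc k))) / real (Suc k)) sums S"
    and le: "ln (norm (euler_prod q / euler_prod (q ^ p))) \<le>
       (1 - 1 / p) * S - ln (1 - norm q) - (Re (q / (1 - q)) + norm q)"
    using ln_norm_euler_prod_div_le [OF nq1 p0(2)] by blast
  define R where "R = Re (q ^ p / (1 - q ^ p))"
  have term_le: "Re (q ^ (p * Suc k) / (1 - q ^ (p * Suc k))) \<le> 1 / (s * p) / real (Suc k)" for k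
  proof -
    let ?z = "q ^ (p * Suc k)"
    have n: "norm ?z = exp (- (s * p * real (Suc k)))"
      unfolding norm_power nq r_def exp_of_nat_mult [symmetric] by (simp add: algebra_simps)
    have "Re (?z / (1 - ?z)) \<le> norm (?z / (1 - ?z))"
      by (rule complex_Re_le_cmod)
    also have "\<dots> \<le> norm ?z / (1 - norm ?z)"
    proof -
      have "1 - norm ?z \<le> norm (1 - ?z)"
        using norm_triangle_ineq2 [of 1 ?z] by simp
      moreover have "1 - norm ?z > 0"
        unfolding n using s p0 by simp
      ultimately show ?thesis
        unfolding norm_divide by (intro divide_left_mono mult_pos_pos) auto
    qed
    also have "\<dots> \<le> 1 / (s * p * real (Suc k))"
      unfolding n using s p0 by (intro exp_div_one_minus_exp_le mult_pos_pos) auto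
    finally show ?thesis
      by (simp only: divide_divide_eq_left mult.assoc)
  qed
  have S_le: "S \<le> pi\<^sup>2 / 6 / (s * p) - (1 / (s * p) - R)"
  proof (rule sums_le [OF _ S])
    have "(\<lambda>k. 1 / real (Suc k) ^ 2) sums (pi\<^sup>2 / 6)"
      using inverse_squares_sums by (simp add: add_ac)
    from sums_diff [OF sums_divide [OF this, of "s * p"] sums_single [of 0 "\<lambda>_. 1 / (s * p) - R"]]
    show "(\<lambda>k. 1 / real (Suc k) ^ 2 / (s * p) - (if k = 0 then 1 / (s * p) - R else 0)) sums
            (pi\<^sup>2 / 6 / (s * p) - (1 / (s * p) - R))" .
    show "Re (q ^ (p * Suc k) / (1 - q ^ (p * Suc k))) / real (Suc k) \<le>
        1 / real (Suc k) ^ 2 / (s * p) - (if k = 0 then 1 / (s * p) - R else 0)" for k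
    proof (cases "k = 0")
      case True
      then show ?thesis by (simp add: R_def)
    next
      case False
      have "Re (q ^ (p * Suc k) / (1 - q ^ (p * Suc k))) / real (Suc k) \<le> 1 / (s * p) / real (Suc k) / real (Suc k)"
        by (rule divide_right_mono [OF term_le]) auto
      then show ?thesis
        using False by (simp add: power2_eq_square mult_ac del: of_nat_Suc)
    qed
  qed
  \<comment> \<open>The target exponent before raising to the power e: the trivial value \<zeta>(2)
    / (s p), less the tenth saved in the first term.\<close>
  define L where "L = (1 - 1 / p) * ((pi\<^sup>2 / 6 - 1 / 10) / (s * p))"
  have "ln (norm (euler_prod q / euler_prod (q ^ p))) \<le> L - ln (1 - r)"
  proof (cases "\<bar>Im t\<bar> \<ge> Re t")
    case True
    have "q ^ p = exp (Complex (- (s * p)) (- (p * Im t)))"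
    proof -
      have "q ^ p = exp (of_nat p * - t)"
        unfolding q_def power_mult_distrib exp_of_nat_mult using p0 by simp
      also have "of_nat p * - t = Complex (- (s * p)) (- (p * Im t))"
        by (simp add: complex_eq_iff s_def)
      finally show ?thesis .
    qed
    \<comment> \<open>The origin of Re t \<le> 1/5: the off-axis estimate is applied to
      \<open>q ^ p\<close>, with s p in the role of s and with phase p Im t, at most \<pi> in
      modulus.\<close>
    moreover have "s * p \<le> 1"
      using mult_mono [OF s(2), of p 5] p0 s by simp
    ultimately have "norm (q ^ p / (1 - q ^ p)) \<le> 9 / (10 * (s * p))"
      using norm_geometric_off_axis_le [of "s * p" "- (p * Im t)"] s p0 True t
      by (simp add: abs_mult s_def field_simps)
    then have "R \<le> 9 / (10 * (s * p))"
      unfolding R_def using complex_Re_le_cmod order_trans by blast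
    then have "S \<le> (pi\<^sup>2 / 6 - 1 / 10) / (s * p)"
      using S_le by (simp add: diff_divide_distrib)
    then have "(1 - 1 / p) * S \<le> L"
      unfolding L_def using p0 by (intro mult_left_mono) auto
    then show ?thesis
      using le Re_geometric_ge [OF nq1] unfolding nq by linarith
  next
    case False
    \<comment> \<open>Near q = 1 \<open>S\<close> gains nothing; the m = 1 term, at least 1 / (4 s),
      more than pays for the 1 / (10 s) that is asked for.\<close>
    then have "p dvd a" using minor by simp
    then have "q = exp (Complex (- s) (- Im t))"
      using p0 by (simp add: q_def unity_root_eq_1_iff [THEN iffD2] s_def complex_eq_iff Re_exp Im_exp)
    then have near: "1 / (4 * s) \<le> Re (q / (1 - q))"
      using Re_geometric_near_1_ge [of s "- Im t"] s False by (simp add: s_def)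
    have "R \<le> 1 / (s * p)"
      using term_le [of 0] by (simp add: R_def)
    then have "S \<le> pi\<^sup>2 / 6 / (s * p)"
      using S_le by simp
    then have "(1 - 1 / p) * S \<le> (1 - 1 / p) * (pi\<^sup>2 / 6 / (s * p))"
      using p0 by (intro mult_left_mono) auto
    also have "\<dots> = L + (1 - 1 / p) / p * (1 / (10 * s))"
      by (simp add: L_def diff_divide_distrib right_diff_distrib)
    also have "(1 - 1 / p) / p * (1 / (10 * s)) \<le> 1 * (1 / (10 * s))"
      using p s by (intro mult_right_mono) auto
    also have "\<dots> \<le> 1 / (4 * s)"
      using s by (simp add: field_simps)
    finally show ?thesis
      using le near norm_ge_zero [of q] unfolding nq by linarith
  qed
  moreover have pos: "norm (euler_prod q / euler_prod (q ^ p)) > 0"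
    using euler_prod_nonzero [OF nq1] euler_prod_nonzero [OF norm_power_less_1 [OF nq1 p0(1)]] by simp
  ultimately have "norm (euler_prod q / euler_prod (q ^ p)) \<le> exp (L - ln (1 - r))"
    by (metis exp_le_cancel_iff exp_ln)
  also have "\<dots> = exp L / (1 - r)"
    using r by (simp add: exp_diff)
  also have "\<dots> \<le> exp L * (2 / s)"
  proof -
    \<comment> \<open>Leads to 1 - r \<ge> s/2: the loss in the Lambert estimate is only the factor
      2/s.\<close>
    have "r * (1 + s) \<le> 1"
      using mult_left_mono [OF exp_ge_add_one_self [of s], of r] r by (simp add: r_def exp_minus)
    moreover have "1 \<le> (1 - s / 2) * (1 + s)"
      using mult_left_mono [of s "1/5" s] s by (simp add: algebra_simps)
    ultimately have "r * (1 + s) \<le> (1 - s / 2) * (1 + s)"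
      by linarith
    then have "s / 2 \<le> 1 - r"
      using s by (simp add: mult_le_cancel_right)
    then have "1 / (1 - r) \<le> 1 / (s / 2)"
      using s by (intro divide_left_mono mult_pos_pos) auto
    then show ?thesis
      using mult_left_mono [of "1 / (1 - r)" "2 / s" "exp L"] by simp
  qed
  finally have "norm (euler_quot p q) \<le> (exp L * (2 / s)) ^ eta_exponent p"
    unfolding euler_quot_def norm_power by (intro power_mono) auto
  also have "\<dots> = (2 / s) ^ eta_exponent p * exp (eta_exponent p * L)"
    by (simp only: power_mult_distrib exp_of_nat_mult) (simp only: mult.commute)
  also have "eta_exponent p * L = ((2 * pi / p)\<^sup>2 - 12 / (5 * p\<^sup>2)) / s"
    using p s by (auto simp: L_def eta_exponent_def field_simps power2_eq_square)
  finally show ?thesis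
    by (simp add: q_def s_def)
qed

subsection \<open>Coefficients as integrals over arcs\<close>

text \<open>The factor 1/q shifts Taylor indices by one, which is the source of \<open>Suc n\<close>
  in all later exponents. At index 0 the added constant e would enter.\<close>

lemma hauptmodul_coeff_eq_deriv:
  assumes p: "p \<in> {2, 3, 5}" and n: "n \<ge> 1"
  shows "hauptmodul_coeff p n = (deriv ^^ Suc n) (euler_quot p) 0 / fact (Suc n)"
proof -
  define a where "a = (\<lambda>n. (deriv ^^ n) (euler_quot p) 0 / fact n)"
  define c where "c = (\<lambda>n. a (Suc n) + (if n = 0 then of_nat (eta_exponent p) else 0))"
  have p0: "p > 0" using p by auto
  have "(\<lambda>n. c n * nome \<tau> ^ n) sums (hauptmodul p \<tau> - inverse (nome \<tau>))" if \<tau>: "Im \<tau> > 0" for \<tau>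
  proof -
    define q where "q = nome \<tau>"
    have q: "q \<noteq> 0" "norm q < 1"
      using norm_nome_less_1 [OF \<tau>] by (auto simp: q_def)
    have "a 0 = 1"
      using p0 by (simp add: a_def euler_quot_def power_0_left)
    moreover have "(\<lambda>n. a n * q ^ n) sums euler_quot p q"
      using holomorphic_power_series [OF euler_quot_holomorphic [OF p0], of q] q by (simp add: a_def)
    ultimately have "(\<lambda>n. a (Suc n) * q ^ Suc n) sums (euler_quot p q - 1)"
      by (subst sums_Suc_iff) simp
    from sums_divide [OF this, of q]
    have "(\<lambda>n. a (Suc n) * q ^ n) sums ((euler_quot p q - 1) / q)"
      using q by simp
    from sums_add [OF this sums_single [of 0 "\<lambda>_. of_nat (eta_exponent p)"]]
    have "(\<lambda>n. a (Suc n) * q ^ n + (if n = 0 then of_nat (eta_exponent p) else 0)) sums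
            ((euler_quot p q - 1) / q + of_nat (eta_exponent p))" .
    moreover have "(\<lambda>n. a (Suc n) * q ^ n + (if n = 0 then of_nat (eta_exponent p) else 0)) =
        (\<lambda>n. c n * q ^ n)"
      by (auto simp: c_def)
    moreover have "(euler_quot p q - 1) / q + of_nat (eta_exponent p) = hauptmodul p \<tau> - inverse q"
      unfolding hauptmodul_eq_euler_quot [OF p] q_def [symmetric] using q by (simp add: field_simps)
    ultimately show ?thesis
      by (simp add: q_def)
  qed
  then have "hauptmodul_coeff p = c"
    using hauptmodul_q_expansion [OF p] by (intro q_expansion_unique)
  then show ?thesis
    using n by (simp add: c_def a_def)
qed

text \<open>Arcs centred at the multiples of T/p fill the interval from -T/(2p) to T - T/(2p);
  periodicity moves the piece below 0 to the end of the period.\<close>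

lemma integral_period_split:
  fixes h :: "real \<Rightarrow> complex" and T :: real and p :: nat
  assumes cont: "continuous_on UNIV h" and per: "\<And>x. h (x + T) = h x" and T: "T > 0" and p: "p > 0"
  shows "integral {0..T} h = (\<Sum>a<p. integral {- (T / (2 * p))..T / (2 * p)} (\<lambda>x. h (a * T / p + x)))"
proof -
  define c where "c = T / (2 * p)"
  have c: "c > 0" and T_eq: "T = 2 * c * p" using T p by (auto simp: c_def)
  have int: "h integrable_on {x..y}" for x y
    by (intro integrable_continuous_real continuous_on_subset [OF cont]) auto
  have "(\<Sum>a<m. integral {- c..c} (\<lambda>x. h (a * T / p + x))) = integral {- c..2 * c * m - c} h" for m :: nat
  proof (induction m)
    case (Suc m)
    have "m * T / p = 2 * c * m"
      using p by (simp add: T_eq)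
    then have "integral {- c..c} (\<lambda>x. h (m * T / p + x)) = integral {- c + 2 * c * m..c + 2 * c * m} h"
      using integral_shift_Icc_real [of "- c" c h "2 * c * m"] by (simp add: o_def)
    also have "{- c + 2 * c * m..c + 2 * c * m} = {2 * c * m - c..2 * c * Suc m - c}"
      by (simp add: algebra_simps)
    finally have "(\<Sum>a<Suc m. integral {- c..c} (\<lambda>x. h (a * T / p + x))) =
        integral {- c..2 * c * m - c} h + integral {2 * c * m - c..2 * c * Suc m - c} h"
      using Suc.IH by simp
    also have "\<dots> = integral {- c..2 * c * Suc m - c} h"
    proof (rule Henstock_Kurzweil_Integration.integral_combine [OF _ _ int])
      show "2 * c * m - c \<le> 2 * c * Suc m - c" "- c \<le> 2 * c * m - c"
        using c by (auto intro!: mult_left_mono)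
    qed
    finally show ?case .
  qed simp
  from this [of p] have "(\<Sum>a<p. integral {- c..c} (\<lambda>x. h (a * T / p + x))) = integral {- c..T - c} h"
    by (simp only: T_eq)
  also have cT: "c \<le> T"
    using c p by (simp add: T_eq)
  have "integral {- c..T - c} h = integral {- c..0} h + integral {0..T - c} h"
    using c cT by (intro Henstock_Kurzweil_Integration.integral_combine [symmetric] int) auto
  also have "integral {- c..0} h = integral {- c + T..0 + T} h"
    using integral_shift_Icc_real [of "- c" 0 h T] per by (simp add: o_def add.commute)
  also have "\<dots> + integral {0..T - c} h = integral {0..T - c} h + integral {T - c..T} h"
    by (simp add: add.commute)
  also have "\<dots> = integral {0..T} h"
    using c cT by (intro Henstock_Kurzweil_Integration.integral_combine int) auto
  finally show ?thesis
    by (simp add: c_def)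
qed

text \<open>Cauchy's integrand for the Taylor coefficient n + 1 in polar coordinates: dq = i q
  d\<phi> cancels one factor of q^(n+2). In the variable of the expansions, t = s - i
  \<phi>.\<close>

definition arc_integrand :: "nat \<Rightarrow> nat \<Rightarrow> nat \<Rightarrow> real \<Rightarrow> real \<Rightarrow> complex" where
  "arc_integrand p n a s \<phi> = (let q = unity_root p a * exp (Complex (- s) \<phi>)
     in euler_quot p q / q ^ Suc n)"

lemma arc_integrand_shift:
  "arc_integrand p n 0 s (2 * pi * real a / real p + \<phi>) = arc_integrand p n a s \<phi>"
proof -
  have "exp (Complex (- s) (2 * pi * real a / real p + \<phi>)) = unity_root p a * exp (Complex (- s) \<phi>)"
    by (simp add: unity_root_def cis_conv_exp exp_add [symmetric] complex_eq_iff)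
       (simp add: Complex_eq exp_add algebra_simps)
  then show ?thesis
    by (simp add: arc_integrand_def unity_root_def)
qed

lemma continuous_on_arc_integrand:
  assumes s: "s > 0" and p: "p > 0"
  shows "continuous_on A (arc_integrand p n a s)"
proof -
  define g where "g = (\<lambda>\<phi>. unity_root p a * exp (Complex (- s) \<phi>))"
  have g: "continuous_on A g"
    unfolding g_def Complex_eq by (intro continuous_intros)
  have "norm (g \<phi>) = exp (- s)" for \<phi>
    by (simp add: g_def norm_mult)
  then have "g ` A \<subseteq> ball 0 1"
    using s by auto
  then have "continuous_on A (\<lambda>\<phi>. euler_quot p (g \<phi>))"
    by (intro continuous_on_compose2 [OF holomorphic_on_imp_continuous_on [OF euler_quot_holomorphic [OF p]] g])
  moreover have "g \<phi> \<noteq> 0" for \<phi>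
    by (simp add: g_def unity_root_def)
  ultimately show ?thesis
    unfolding arc_integrand_def Let_def g_def [symmetric]
    by (intro continuous_intros g) (auto simp: g_def unity_root_def)
qed

lemma hauptmodul_coeff_eq_sum_integrals:
  assumes p: "p \<in> {2, 3, 5}" and n: "n \<ge> 1" and s: "s > 0"
  shows "of_real (2 * pi) * hauptmodul_coeff p n =
    (\<Sum>a<p. integral {- (pi / p)..pi / p} (arc_integrand p n a s))"
proof -
  have p0: "p > 0" using p by auto
  define r where "r = exp (- s)"
  have r: "0 < r" "r < 1" using s by (auto simp: r_def)
  let ?D = "(2 * pi * \<i>) / fact (Suc n) * (deriv ^^ Suc n) (euler_quot p) 0"
  have hol: "euler_quot p holomorphic_on cball 0 r"
    by (rule holomorphic_on_subset [OF euler_quot_holomorphic [OF p0]]) (use r in auto)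
  have "((\<lambda>u. euler_quot p u / (u - 0) ^ Suc (Suc n)) has_contour_integral ?D) (circlepath 0 r)"
    by (rule Cauchy_has_contour_integral_higher_derivative_circlepath)
      (use r hol in \<open>auto intro: holomorphic_on_imp_continuous_on holomorphic_on_subset\<close>)
  then have "((\<lambda>t. euler_quot p (0 + r * cis t) / (0 + r * cis t - 0) ^ Suc (Suc n) * r * \<i> * cis t)
      has_integral ?D) {0..2 * pi}"
    unfolding circlepath_def by (subst (asm) has_contour_integral_part_circlepath_iff) auto
  moreover have "euler_quot p (0 + r * cis t) / (0 + r * cis t - 0) ^ Suc (Suc n) * r * \<i> * cis t =
      \<i> * arc_integrand p n 0 s t" for t
  proof -
    have "exp (Complex (- s) t) = r * cis t"
      by (simp add: exp_eq_polar r_def)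
    then show ?thesis
      using r by (simp add: arc_integrand_def unity_root_def Let_def mult_ac)
  qed
  ultimately have "((\<lambda>t. \<i> * arc_integrand p n 0 s t) has_integral ?D) {0..2 * pi}"
    by (simp only:)
  from has_integral_mult_right [OF this, of "- \<i>"]
  have "(arc_integrand p n 0 s has_integral (- \<i> * ?D)) {0..2 * pi}"
    by simp
  then have "integral {0..2 * pi} (arc_integrand p n 0 s) = - \<i> * ?D"
    by (rule integral_unique)
  also have "\<dots> = of_real (2 * pi) * hauptmodul_coeff p n"
    unfolding hauptmodul_coeff_eq_deriv [OF p n] by (simp add: field_simps)
  finally have "of_real (2 * pi) * hauptmodul_coeff p n = integral {0..2 * pi} (arc_integrand p n 0 s)" ..
  also have "\<dots> = (\<Sum>a<p. integral {- (2 * pi / (2 * p))..2 * pi / (2 * p)}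
      (\<lambda>x. arc_integrand p n 0 s (a * (2 * pi) / p + x)))"
  proof (rule integral_period_split)
    show "arc_integrand p n 0 s (x + 2 * pi) = arc_integrand p n 0 s x" for x
    proof -
      have "exp (Complex (- s) (x + 2 * pi)) = exp (Complex (- s) x)"
        by (simp add: complex_eq_iff Re_exp Im_exp)
      then show ?thesis by (simp add: arc_integrand_def)
    qed
  qed (use s p0 continuous_on_arc_integrand in auto)
  also have "\<dots> = (\<Sum>a<p. integral {- (pi / p)..pi / p} (arc_integrand p n a s))"
  proof (rule sum.cong [OF refl])
    fix a
    have "(\<lambda>x. arc_integrand p n 0 s (a * (2 * pi) / p + x)) = arc_integrand p n a s"
      using arc_integrand_shift [of p n s a] by (simp add: mult_ac)
    then show "integral {- (2 * pi / (2 * p))..2 * pi / (2 * p)}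
        (\<lambda>x. arc_integrand p n 0 s (a * (2 * pi) / p + x)) =
        integral {- (pi / p)..pi / p} (arc_integrand p n a s)"
      by simp
  qed
  finally show ?thesis .
qed

lemma has_integral_gaussian:
  assumes "A > 0"
  shows "((\<lambda>x. exp (- (A * x\<^sup>2))) has_integral sqrt (pi / A)) UNIV"
proof -
  define \<sigma> where "\<sigma> = sqrt (1 / (2 * A))"
  have \<sigma>: "\<sigma> > 0" "\<sigma>\<^sup>2 = 1 / (2 * A)" using assms by (auto simp: \<sigma>_def)
  have "has_bochner_integral lborel (normal_density 0 \<sigma>) 1"
    using integral_normal_density [OF \<sigma>(1), of 0] integrable_normal_density [OF \<sigma>(1), of 0]
    by (simp add: has_bochner_integral_iff)
  then have "has_bochner_integral lborel (\<lambda>x. sqrt (pi / A) * normal_density 0 \<sigma> x) (sqrt (pi / A) * 1)"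
    by (rule has_bochner_integral_mult_right)
  moreover have "sqrt (pi / A) * normal_density 0 \<sigma> x = exp (- (A * x\<^sup>2))" for x
    using assms by (simp add: normal_density_def \<sigma>(2) real_sqrt_divide)
  ultimately have "has_bochner_integral lborel (\<lambda>x. exp (- (A * x\<^sup>2))) (sqrt (pi / A))"
    by simp
  then show ?thesis
    by (auto simp: has_bochner_integral_iff dest: has_integral_integral_lborel)
qed

subsection \<open>The saddle point\<close>

text \<open>An exact identity instead of a Taylor expansion at the saddle t = A / sqrt n: with t = s
  u both terms have weight A sqrt n, and 1/u + u - 2 = (u - 1)^2 / u = -\<theta>^2 / u for u = 1 - i
  \<theta>.\<close>

lemma saddle_identity:
  fixes A \<theta> :: real and n :: nat
  assumes "n > 0" "A > 0"
  defines "s \<equiv> A / sqrt n"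
  defines "t \<equiv> Complex s (- (s * \<theta>))"
  shows "of_real (A\<^sup>2) / t + of_nat n * t =
    of_real (2 * A * sqrt n) - of_real (A * sqrt n * \<theta>\<^sup>2) / (1 - \<i> * of_real \<theta>)"
proof -
  define u where "u = 1 - \<i> * of_real \<theta>"
  have "Re u = 1" by (simp add: u_def)
  then have u: "u \<noteq> 0" by auto
  have t: "t = of_real s * u"
    by (simp add: t_def u_def complex_eq_iff)
  have "A\<^sup>2 / s = A * sqrt n" "real n * s = A * sqrt n"
    using assms by (simp_all add: s_def power2_eq_square field_simps)
  then have "of_real (A\<^sup>2) / of_real s = (of_real (A * sqrt n) :: complex)"
    "of_nat n * of_real s = (of_real (A * sqrt n) :: complex)"
    by (metis of_real_divide) (metis \<open>real n * s = A * sqrt n\<close> of_real_mult of_real_of_nat_eq)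
  then have "of_real (A\<^sup>2) / t + of_nat n * t = of_real (A * sqrt n) * (1 / u + u)"
    unfolding t divide_divide_eq_left [symmetric] mult.assoc [symmetric] by (simp add: distrib_left)
  also have "1 / u + u = 2 - of_real (\<theta>\<^sup>2) / u"
    using u by (simp add: field_simps) (simp add: u_def power2_eq_square algebra_simps)
  finally show ?thesis
    by (simp add: u_def right_diff_distrib)
qed

text \<open>The saddle is taken for exponent n although the integrand has q^(n+1). The surplus
  factor exp t joins the error, which becomes \<delta> + t; since |t| \<le> 2 s = 2 A / sqrt n on
  the arc, it is still O(1 / sqrt n).\<close>

lemma arc_integrand_main:
  assumes p: "p \<in> {2, 3, 5}" and a: "coprime a p"
  defines "A \<equiv> 2 * pi / p"
  obtains C where "C > 0"
    "\<And>n \<theta>. \<lbrakk>n > 0; real p * (A / sqrt n) \<le> 1; \<bar>\<theta>\<bar> \<le> 1\<rbrakk> \<Longrightarrow>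
      \<exists>\<delta>. norm \<delta> \<le> C / sqrt n \<and>
        arc_integrand p n a (A / sqrt n) (A / sqrt n * \<theta>) =
          cusp_const p a * inverse (unity_root p a) ^ Suc n * of_real (exp (2 * A * sqrt n)) *
          exp (- (of_real (A * sqrt n * \<theta>\<^sup>2) / (1 - \<i> * of_real \<theta>))) * exp \<delta>"
proof -
  obtain C where C: "C > 0" and F: "\<And>t. \<lbrakk>0 < Re t; real p * Re t \<le> 1; \<bar>Im t\<bar> \<le> Re t\<rbrakk> \<Longrightarrow>
      \<exists>\<delta>. norm \<delta> \<le> C * norm t \<and>
        euler_quot p (unity_root p a * exp (- t)) =
          cusp_const p a * exp (of_real ((2 * pi / p)\<^sup>2) / t) * exp \<delta>"
    using euler_quot_near_unity_root [OF p a] by blast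
  have A: "A > 0" using p by (auto simp: A_def)
  show ?thesis
  proof (rule that [of "(C + 1) * (2 * A)"])
    fix n :: nat and \<theta> :: real
    assume n: "n > 0" and ps: "real p * (A / sqrt n) \<le> 1" and \<theta>: "\<bar>\<theta>\<bar> \<le> 1"
    define s where "s = A / sqrt n"
    have s: "s > 0" using A n by (simp add: s_def)
    define t where "t = Complex s (- (s * \<theta>))"
    have "\<bar>Im t\<bar> \<le> Re t"
      using mult_left_mono [OF \<theta>, of s] s by (simp add: t_def abs_mult)
    then obtain \<delta> where \<delta>: "norm \<delta> \<le> C * norm t" and eq: "euler_quot p (unity_root p a * exp (- t)) =
        cusp_const p a * exp (of_real (A\<^sup>2) / t) * exp \<delta>"
      using F [of t] s ps by (auto simp: t_def s_def A_def)
    have nt: "norm t \<le> 2 * s"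
      using cmod_le [of t] \<open>\<bar>Im t\<bar> \<le> Re t\<close> s by (simp add: t_def)
    have "norm (\<delta> + t) \<le> C * norm t + norm t"
      using \<delta> norm_triangle_ineq [of \<delta> t] by simp
    also have "\<dots> = (C + 1) * norm t" by (simp add: algebra_simps)
    also have "\<dots> \<le> (C + 1) * (2 * s)"
      using nt C by (intro mult_left_mono) auto
    also have "\<dots> = (C + 1) * (2 * A) / sqrt n" by (simp add: s_def)
    finally have bd: "norm (\<delta> + t) \<le> (C + 1) * (2 * A) / sqrt n" .
    have "Complex (- s) (s * \<theta>) = - t"
      by (simp add: t_def complex_eq_iff)
    then have "arc_integrand p n a s (s * \<theta>) =
        euler_quot p (unity_root p a * exp (- t)) / (unity_root p a * exp (- t)) ^ Suc n"
      by (simp add: arc_integrand_def Let_def)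
    also have "(unity_root p a * exp (- t)) ^ Suc n = unity_root p a ^ Suc n * exp (- (of_nat n * t + t))"
      unfolding power_mult_distrib exp_of_nat_mult [symmetric] by (simp add: algebra_simps)
    also have "euler_quot p (unity_root p a * exp (- t)) / \<dots> =
        cusp_const p a * inverse (unity_root p a) ^ Suc n *
          exp (of_real (A\<^sup>2) / t + of_nat n * t) * exp (\<delta> + t)"
    proof -
      have e: "exp (- (of_nat n * t + t)) = inverse (exp (of_nat n * t) * exp t)"
        by (simp only: exp_minus exp_add)
      show ?thesis
        unfolding eq e exp_add by (simp add: divide_inverse power_inverse mult_ac del: power_Suc)
    qed
    also have "exp (of_real (A\<^sup>2) / t + of_nat n * t) =
        of_real (exp (2 * A * sqrt n)) * exp (- (of_real (A * sqrt n * \<theta>\<^sup>2) / (1 - \<i> * of_real \<theta>)))"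
      unfolding t_def s_def saddle_identity [OF n A]
      by (simp only: exp_of_real [symmetric] exp_add [symmetric] diff_conv_add_uminus)
    finally show "\<exists>\<delta>. norm \<delta> \<le> (C + 1) * (2 * A) / sqrt n \<and>
        arc_integrand p n a (A / sqrt n) (A / sqrt n * \<theta>) =
          cusp_const p a * inverse (unity_root p a) ^ Suc n * of_real (exp (2 * A * sqrt n)) *
          exp (- (of_real (A * sqrt n * \<theta>\<^sup>2) / (1 - \<i> * of_real \<theta>))) * exp \<delta>"
      using bd unfolding s_def by (intro exI [of _ "\<delta> + t"]) (simp only: mult.assoc simp_thms)
  qed (use A C in auto)
qed

text \<open>Re (1 / (1 - i \<theta>)) = 1 / (1 + \<theta>^2) \<ge> 1/2 on the main arc; this
  provides a Gaussian majorant independent of n.\<close>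

lemma norm_saddle_exp_le:
  assumes "\<bar>\<theta>\<bar> \<le> 1" "x \<ge> 0"
  shows "norm (exp (- (of_real x / (1 - \<i> * of_real \<theta>)))) \<le> exp (- (x / 2))"
proof -
  have "Re (of_real x / (1 - \<i> * of_real \<theta>)) = x / (1 + \<theta>\<^sup>2)"
    by (simp add: Re_divide)
  moreover have "\<theta>\<^sup>2 \<le> 1"
    using assms(1) by (simp add: abs_square_le_1)
  then have "x / 2 \<le> x / (1 + \<theta>\<^sup>2)"
    using assms(2) by (intro divide_left_mono) (auto intro: add_pos_nonneg)
  ultimately show ?thesis
    by (simp add: norm_exp_eq_Re)
qed

text \<open>Substituting \<phi> = (A / sqrt n) v / n^(1/4) turns the exponent into A v^2 / (1 - i v
  / n^(1/4)). Dominated convergence yields the Gaussian integral sqrt (\<pi>/A), and the Jacobian A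
  n^(-3/4) accounts for n^(3/4) and for A sqrt (\<pi>/A) = sqrt (\<pi> A).\<close>

lemma main_arc_limit:
  assumes p: "p \<in> {2, 3, 5}" and a: "coprime a p"
  defines "A \<equiv> 2 * pi / p"
  shows "(\<lambda>n. integral {- (A / sqrt n)..A / sqrt n} (arc_integrand p n a (A / sqrt n)) /
      (of_real (exp (2 * A * sqrt n) / real n powr (3/4)) * inverse (unity_root p a) ^ Suc n))
    \<longlonglongrightarrow> cusp_const p a * of_real (sqrt (pi * A))"
proof -
  have A: "A > 0" and p0: "p > 0" using p by (auto simp: A_def)
  obtain C where C: "C > 0" and main: "\<And>n \<theta>. \<lbrakk>n > 0; real p * (A / sqrt n) \<le> 1; \<bar>\<theta>\<bar> \<le> 1\<rbrakk> \<Longrightarrow>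
      \<exists>\<delta>. norm \<delta> \<le> C / sqrt n \<and>
        arc_integrand p n a (A / sqrt n) (A / sqrt n * \<theta>) =
          cusp_const p a * inverse (unity_root p a) ^ Suc n * of_real (exp (2 * A * sqrt n)) *
          exp (- (of_real (A * sqrt n * \<theta>\<^sup>2) / (1 - \<i> * of_real \<theta>))) * exp \<delta>"
    using arc_integrand_main [OF p a] unfolding A_def by blast
  have "(\<lambda>n. real p * (A / sqrt n)) \<longlonglongrightarrow> 0"
    by real_asymp
  then have "\<forall>\<^sub>F n in sequentially. real p * (A / sqrt n) < 1"
    by (rule order_tendstoD) auto
  then obtain N0 :: nat where N0: "\<And>n. n \<ge> N0 \<Longrightarrow> real p * (A / sqrt n) < 1"
    unfolding eventually_sequentially by blast
  define N where "N = max N0 1"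
  have N: "n > 0" "real p * (A / sqrt n) \<le> 1" if "n \<ge> N" for n :: nat
    using that N0 [of n] by (auto simp: N_def)
  \<comment> \<open>The width of the saddle: n^(1/4) is the scale on which A sqrt n \<theta>^2 is of
    order 1.\<close>
  define R where "R = (\<lambda>n :: nat. real n powr (1/4))"
  have R_pos: "R n > 0" if "n > 0" for n using that by (simp add: R_def)
  have R2: "(R n)\<^sup>2 = sqrt n" for n
    by (cases "n = 0") (simp_all add: R_def power2_eq_square powr_add [symmetric] powr_half_sqrt)
  define K where "K = (\<lambda>n v. arc_integrand p n a (A / sqrt n) (A / sqrt n * (v / R n)) /
      (of_real (exp (2 * A * sqrt n)) * inverse (unity_root p a) ^ Suc n))"
  define G where "G = (\<lambda>n v. if v \<in> {- R n..R n} then K n v else 0)"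
  have u0: "unity_root p a \<noteq> 0" by (simp add: unity_root_def)
  have K: "\<exists>\<delta>. norm \<delta> \<le> C / sqrt n \<and>
      K n v = cusp_const p a * exp (- (of_real (A * v\<^sup>2) / (1 - \<i> * of_real (v / R n)))) * exp \<delta>"
    if n: "n \<ge> N" and v: "\<bar>v\<bar> \<le> R n" for n v
  proof -
    have "\<bar>v / R n\<bar> \<le> 1"
      using v R_pos N [OF n] by (simp add: abs_divide)
    from main [OF N [OF n] this] obtain \<delta> where \<delta>: "norm \<delta> \<le> C / sqrt n"
      and eq: "arc_integrand p n a (A / sqrt n) (A / sqrt n * (v / R n)) =
          cusp_const p a * inverse (unity_root p a) ^ Suc n * of_real (exp (2 * A * sqrt n)) *
          exp (- (of_real (A * sqrt n * (v / R n)\<^sup>2) / (1 - \<i> * of_real (v / R n)))) * exp \<delta>"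
      by blast
    have e: "A * sqrt n * (v / R n)\<^sup>2 = A * v\<^sup>2"
      using N [OF n] by (simp add: power_divide R2)
    show ?thesis
      using \<delta> u0 unfolding K_def eq e by (intro exI [of _ \<delta>]) simp
  qed
  have lim: "(\<lambda>n. integral UNIV (G n)) \<longlonglongrightarrow> cusp_const p a * of_real (sqrt (pi / A))"
  proof -
    define h where "h = (\<lambda>v. norm (cusp_const p a) * exp (- (A / 2 * v\<^sup>2)) * exp C)"
    have "(\<lambda>v. exp (- (A / 2 * v\<^sup>2))) integrable_on UNIV"
      by (rule has_integral_integrable [OF has_integral_gaussian]) (use A in simp)
    then have h: "h integrable_on UNIV"
      unfolding h_def by (intro integrable_on_mult_left integrable_on_mult_right)
    \<comment> \<open>The shift by N makes the majorant valid for every index of the sequence, as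
      dominated convergence requires.\<close>
    have "(\<lambda>k. integral UNIV (G (k + N))) \<longlonglongrightarrow>
        integral UNIV (\<lambda>v. cusp_const p a * of_real (exp (- (A * v\<^sup>2))))"
    proof (rule dominated_convergence(2) [OF _ h])
      show "G (k + N) integrable_on UNIV" for k
      proof -
        have "continuous_on {- R (k + N)..R (k + N)} (K (k + N))"
          unfolding K_def using u0 A N [of "k + N"] R_pos [of "k + N"] p0
          by (intro continuous_on_divide continuous_on_const
              continuous_on_compose2 [OF continuous_on_arc_integrand [of _ _ UNIV]] continuous_intros) auto
        then show ?thesis
          unfolding G_def by (subst integrable_restrict_UNIV) (rule integrable_continuous_real)
      qed
      show "norm (G (k + N) v) \<le> h v" for k v
      proof (cases "v \<in> {- R (k + N)..R (k + N)}")
        case True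
        then have v: "\<bar>v\<bar> \<le> R (k + N)" by auto
        obtain \<delta> where \<delta>: "norm \<delta> \<le> C / sqrt (k + N)" and eq: "K (k + N) v =
            cusp_const p a * exp (- (of_real (A * v\<^sup>2) / (1 - \<i> * of_real (v / R (k + N))))) * exp \<delta>"
          using K [OF _ v] by auto
        have "real (k + N) \<ge> 1"
          using N(1) [of "k + N"] by linarith
        then have "sqrt (k + N) \<ge> 1"
          by (rule real_sqrt_ge_one)
        then have "C / sqrt (k + N) \<le> C / 1"
          using C by (intro divide_left_mono) auto
        then have "norm \<delta> \<le> C"
          using \<delta> by simp
        then have "exp (norm \<delta>) \<le> exp C"
          by simp
        then have "norm (exp \<delta>) \<le> exp C"
          by (rule order_trans [OF norm_exp])
        moreover have "norm (exp (- (of_real (A * v\<^sup>2) / (1 - \<i> * of_real (v / R (k + N)))))) \<le> exp (- (A * v\<^sup>2 / 2))"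
          using v R_pos N [of "k + N"] A by (intro norm_saddle_exp_le) (auto simp: abs_divide)
        ultimately have "norm (K (k + N) v) \<le> norm (cusp_const p a) * exp (- (A * v\<^sup>2 / 2)) * exp C"
          unfolding eq norm_mult by (intro mult_mono) auto
        then show ?thesis
          using True by (simp add: G_def h_def)
      next
        case False
        then have "G (k + N) v = 0" unfolding G_def by (rule if_not_P)
        then show ?thesis by (simp add: h_def)
      qed
      show "(\<lambda>k. G (k + N) v) \<longlonglongrightarrow> cusp_const p a * of_real (exp (- (A * v\<^sup>2)))" for v
      proof -
        have R_lim: "filterlim R at_top sequentially"
          unfolding R_def by real_asymp
        then have "\<forall>\<^sub>F n in sequentially. \<bar>v\<bar> \<le> R n"
          by (simp add: filterlim_at_top)
        then have ev: "\<forall>\<^sub>F n in sequentially. n \<ge> N \<and> \<bar>v\<bar> \<le> R n"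
          using eventually_ge_at_top [of N] by eventually_elim auto
        obtain \<delta> where \<delta>: "\<And>n. n \<ge> N \<and> \<bar>v\<bar> \<le> R n \<Longrightarrow> norm (\<delta> n) \<le> C / sqrt n \<and>
            K n v = cusp_const p a * exp (- (of_real (A * v\<^sup>2) / (1 - \<i> * of_real (v / R n)))) * exp (\<delta> n)"
          using K [of _ v] by metis
        have "(\<lambda>n. C / sqrt n) \<longlonglongrightarrow> 0"
          by real_asymp
        then have \<delta>0: "\<delta> \<longlonglongrightarrow> 0"
          by (rule Lim_null_comparison [rotated]) (use ev \<delta> in \<open>auto elim: eventually_mono\<close>)
        have "(\<lambda>n. v / R n) \<longlonglongrightarrow> 0"
          by (rule real_tendsto_divide_at_top [OF tendsto_const R_lim])
        then have "(\<lambda>n. cusp_const p a * exp (- (of_real (A * v\<^sup>2) / (1 - \<i> * of_real (v / R n)))) * exp (\<delta> n))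
            \<longlonglongrightarrow> cusp_const p a * exp (- (of_real (A * v\<^sup>2) / (1 - \<i> * of_real 0))) * exp 0"
          by (intro tendsto_mult tendsto_const tendsto_exp tendsto_minus tendsto_divide tendsto_diff
              tendsto_of_real \<delta>0) auto
        also have "cusp_const p a * exp (- (of_real (A * v\<^sup>2) / (1 - \<i> * of_real 0))) * exp 0 =
            cusp_const p a * of_real (exp (- (A * v\<^sup>2)))"
          by (simp add: exp_of_real [symmetric])
        finally have "(\<lambda>n. cusp_const p a * exp (- (of_real (A * v\<^sup>2) / (1 - \<i> * of_real (v / R n)))) * exp (\<delta> n))
            \<longlonglongrightarrow> cusp_const p a * of_real (exp (- (A * v\<^sup>2)))" .
        moreover have "\<forall>\<^sub>F n in sequentially.
            cusp_const p a * exp (- (of_real (A * v\<^sup>2) / (1 - \<i> * of_real (v / R n)))) * exp (\<delta> n) = G n v"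
          using ev by eventually_elim (use \<delta> in \<open>auto simp: G_def\<close>)
        ultimately have "(\<lambda>n. G n v) \<longlonglongrightarrow> cusp_const p a * of_real (exp (- (A * v\<^sup>2)))"
          by (rule Lim_transform_eventually)
        then show ?thesis
          by (rule LIMSEQ_ignore_initial_segment)
      qed
    qed
    also have "integral UNIV (\<lambda>v. cusp_const p a * of_real (exp (- (A * v\<^sup>2)))) =
        cusp_const p a * of_real (sqrt (pi / A))"
      by (intro integral_unique has_integral_mult_right has_integral_of_real has_integral_gaussian A)
    finally show ?thesis
      by (rule LIMSEQ_offset)
  qed
  have eq: "of_real A * integral UNIV (G n) =
      integral {- (A / sqrt n)..A / sqrt n} (arc_integrand p n a (A / sqrt n)) /
      (of_real (exp (2 * A * sqrt n) / real n powr (3/4)) * inverse (unity_root p a) ^ Suc n)"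
    if n: "n > 0" for n
  proof -
    \<comment> \<open>The Jacobian of the substitution, A / n^(3/4).\<close>
    define m where "m = A / sqrt n / R n"
    have R: "R n > 0" using R_pos [OF n] .
    have m: "m > 0" using A n R by (simp add: m_def)
    have m_eq: "m = A / real n powr (3/4)"
      using n by (simp add: m_def R_def powr_half_sqrt [symmetric] powr_add [symmetric] divide_divide_eq_left)
    have img: "(\<lambda>x. x / m) ` {- (A / sqrt n)..A / sqrt n} = {- R n..R n}"
    proof -
      have "A / sqrt n / m = R n" using A n R by (simp add: m_def)
      then show ?thesis
        using m A n by (simp add: image_divide_atLeastAtMost)
    qed
    have "integral UNIV (G n) = integral {- R n..R n} (K n)"
      unfolding G_def by (rule integral_restrict_UNIV)
    also have "\<dots> = integral {- R n..R n} (\<lambda>v. arc_integrand p n a (A / sqrt n) (m * v)) /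
        (of_real (exp (2 * A * sqrt n)) * inverse (unity_root p a) ^ Suc n)"
      unfolding K_def by (simp add: m_def)
    also have "integral {- R n..R n} (\<lambda>v. arc_integrand p n a (A / sqrt n) (m * v)) =
        of_real (1 / m) * integral {- (A / sqrt n)..A / sqrt n} (arc_integrand p n a (A / sqrt n))"
      using integral_stretch_real [of m "- (A / sqrt n)" "A / sqrt n" "arc_integrand p n a (A / sqrt n)"] m
      unfolding img by (simp add: scaleR_conv_of_real)
    finally show ?thesis
      using A n by (simp add: m_eq)
  qed
  have "of_real A * (cusp_const p a * of_real (sqrt (pi / A))) = cusp_const p a * of_real (A * sqrt (pi / A))"
    by simp
  also have "A * sqrt (pi / A) = sqrt (pi * A)"
  proof -
    have "A = sqrt (A * A)" using A by simp
    then have "A * sqrt (pi / A) = sqrt (A * A * (pi / A))"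
      unfolding real_sqrt_mult by simp
    also have "A * A * (pi / A) = pi * A" using A by simp
    finally show ?thesis .
  qed
  finally have L: "of_real A * (cusp_const p a * of_real (sqrt (pi / A))) = cusp_const p a * of_real (sqrt (pi * A))" .
  have "(\<lambda>n. of_real A * integral UNIV (G n)) \<longlonglongrightarrow> cusp_const p a * of_real (sqrt (pi * A))"
    using tendsto_mult [OF tendsto_const lim, of "of_real A"] unfolding L .
  moreover have "\<forall>\<^sub>F n in sequentially. of_real A * integral UNIV (G n) =
      integral {- (A / sqrt n)..A / sqrt n} (arc_integrand p n a (A / sqrt n)) /
      (of_real (exp (2 * A * sqrt n) / real n powr (3/4)) * inverse (unity_root p a) ^ Suc n)"
    using eventually_gt_at_top [of 0] by eventually_elim (rule eq)
  ultimately show ?thesis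
    by (rule Lim_transform_eventually)
qed

section \<open>Assembling the arcs on the saddle circle\<close>

text \<open>On the saddle circle A^2/s and s n both equal A sqrt n, so the trivial constant
  reproduces the main growth exp (2 A sqrt n) and the saving remains as a separate factor.\<close>

lemma minor_arc_integrand_bound:
  fixes n :: nat
  assumes p: "p \<in> {2, 3, 5}"
  defines "A \<equiv> 2 * pi / p"
  defines "s \<equiv> A / sqrt n"
  assumes n: "n > 0" and s: "s \<le> 1 / 5" and \<phi>: "\<bar>\<phi>\<bar> \<le> pi / p" and minor: "\<bar>\<phi>\<bar> \<ge> s \<or> p dvd a"
  shows "norm (arc_integrand p n a s \<phi>) \<le>
    exp (2 * A * sqrt n) * ((2 / s) ^ eta_exponent p * exp s * exp (- (12 / (5 * (real p)\<^sup>2)) / s))"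
proof -
  have A: "A > 0" using p by (auto simp: A_def)
  have s0: "s > 0" using A n by (simp add: s_def)
  define t where "t = Complex s (- \<phi>)"
  have t: "Complex (- s) \<phi> = - t" "Re t = s" "\<bar>Im t\<bar> = \<bar>\<phi>\<bar>"
    by (simp_all add: t_def complex_eq_iff)
  have "norm (arc_integrand p n a s \<phi>) = norm (euler_quot p (unity_root p a * exp (- t))) * exp (s * real (Suc n))"
  proof -
    have "norm ((unity_root p a * exp (- t)) ^ Suc n) = exp (- (s * real (Suc n)))"
      unfolding norm_power norm_mult norm_unity_root norm_exp_eq_Re mult_1
      by (simp only: exp_of_nat_mult [symmetric]) (simp add: t algebra_simps)
    then show ?thesis
      unfolding arc_integrand_def Let_def t(1) norm_divide by (simp add: exp_minus divide_inverse del: power_Suc of_nat_Suc)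
  qed
  also have "\<dots> \<le> ((2 / s) ^ eta_exponent p * exp ((A\<^sup>2 - 12 / (5 * (real p)\<^sup>2)) / s)) * exp (s * real (Suc n))"
    using euler_quot_minor_arc_bound [OF p, of t a] s s0 \<phi> minor
    by (intro mult_right_mono) (auto simp: t A_def)
  also have "\<dots> = (2 / s) ^ eta_exponent p * exp ((A\<^sup>2 - 12 / (5 * (real p)\<^sup>2)) / s + s * real (Suc n))"
    by (simp add: exp_add del: of_nat_Suc)
  also have "(A\<^sup>2 - 12 / (5 * (real p)\<^sup>2)) / s + s * real (Suc n) =
      2 * A * sqrt n + s + - (12 / (5 * (real p)\<^sup>2)) / s"
  proof -
    have "A\<^sup>2 / s = A * sqrt n" "s * real n = A * sqrt n"
      using A n by (simp_all add: s_def power2_eq_square field_simps)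
    then show ?thesis
      by (simp add: diff_divide_distrib distrib_left)
  qed
  finally show ?thesis
    unfolding exp_add by (simp only: mult_ac)
qed

lemma minor_arc_negligible:
  assumes e: "e \<in> {6, 12, 24 :: nat}" and A: "A > 0" and \<epsilon>: "\<epsilon> > (0 :: real)"
  shows "(\<lambda>n. (2 / (A / sqrt (real n))) ^ e * exp (A / sqrt n) * exp (- \<epsilon> / (A / sqrt n)) * real n powr (3/4))
    \<longlonglongrightarrow> 0"
  using e
proof (elim insertE emptyE)
  assume e: "e = 6"
  show ?thesis using A \<epsilon> unfolding e by real_asymp
next
  assume e: "e = 12"
  show ?thesis using A \<epsilon> unfolding e by real_asymp
next
  assume e: "e = 24"
  show ?thesis using A \<epsilon> unfolding e by real_asymp
qed

lemma coprime_less_prime: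
  fixes a p :: nat
  assumes "prime p" "0 < a" "a < p"
  shows "coprime a p"
  using assms by (metis coprime_commute dvd_imp_le linorder_not_le prime_imp_coprime)

text \<open>A difference tending to 0 is the right form, because the factor \<zeta>^(-a(n+1))
  rotates with n and has no limit. The arc at a = 0 is entirely minor; every other arc splits into a
  main piece between two minor ones.\<close>

lemma arc_integral_asymp:
  assumes p: "p \<in> {2, 3, 5}" and a: "a < p"
  defines "A \<equiv> 2 * pi / p"
  defines "E \<equiv> \<lambda>n. exp (2 * A * sqrt (real n)) / real n powr (3/4)"
  shows "(\<lambda>n. integral {- (pi / p)..pi / p} (arc_integrand p n a (A / sqrt n)) / of_real (E n) -
      (if a = 0 then 0 else inverse (unity_root p a) ^ Suc n * (cusp_const p a * of_real (sqrt (pi * A)))))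
    \<longlonglongrightarrow> 0"
proof -
  have A: "A > 0" and p0: "p > 0" using p by (auto simp: A_def)
  define M where "M = (\<lambda>n. (2 / (A / sqrt (real n))) ^ eta_exponent p * exp (A / sqrt n) *
      exp (- (12 / (5 * (real p)\<^sup>2)) / (A / sqrt n)) * real n powr (3/4))"
  have M: "M \<longlonglongrightarrow> 0"
    unfolding M_def using p A by (intro minor_arc_negligible) (auto simp: eta_exponent_def)
  have int: "arc_integrand p n a (A / sqrt n) integrable_on {x..y}" if "n > 0" for n x y
    using that A p0 by (intro integrable_continuous_real continuous_on_arc_integrand) auto
  have "(\<lambda>n. A / sqrt (real n)) \<longlonglongrightarrow> 0"
    using A by real_asymp
  \<comment> \<open>1/5 makes the minor arc bound applicable; \<pi>/p ensures that the main piece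
    fits into its arc.\<close>
  moreover have "min (1/5) (pi / p) > 0"
    using p0 by simp
  ultimately have "\<forall>\<^sub>F n in sequentially. A / sqrt (real n) < min (1/5) (pi / p)"
    by (rule order_tendstoD)
  then have large: "\<forall>\<^sub>F n in sequentially. n > 0 \<and> A / sqrt (real n) \<le> 1/5 \<and> A / sqrt (real n) \<le> pi / p"
    using eventually_gt_at_top [of 0] by eventually_elim auto
  have minor: "norm (integral {x..y} (arc_integrand p n a (A / sqrt n)) / of_real (E n)) \<le> M n * (y - x)"
    if n: "n > 0" "A / sqrt (real n) \<le> 1/5" and xy: "x \<le> y"
      and sub: "\<And>\<phi>. \<phi> \<in> {x..y} \<Longrightarrow> \<bar>\<phi>\<bar> \<le> pi / p \<and> (\<bar>\<phi>\<bar> \<ge> A / sqrt n \<or> p dvd a)" for n x y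
  proof -
    have E: "E n > 0" using n by (simp add: E_def)
    have "norm (integral {x..y} (arc_integrand p n a (A / sqrt n))) \<le> (E n * M n) * (y - x)"
    proof (rule integral_bound [OF xy])
      show "continuous_on {x..y} (arc_integrand p n a (A / sqrt n))"
        using n A p0 by (intro continuous_on_arc_integrand) auto
      show "norm (arc_integrand p n a (A / sqrt n) \<phi>) \<le> E n * M n" if "\<phi> \<in> {x..y}" for \<phi>
        using minor_arc_integrand_bound [OF p n(1), of \<phi> a] sub [OF that] n
        by (simp add: A_def E_def M_def mult_ac)
    qed
    then show ?thesis
      using E by (simp add: norm_divide field_simps)
  qed
  show ?thesis
  proof (cases "a = 0")
    case True
    have "(\<lambda>n. M n * (pi / p - - (pi / p))) \<longlonglongrightarrow> 0"
      by (rule tendsto_mult_left_zero [OF M])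
    then have "(\<lambda>n. integral {- (pi / p)..pi / p} (arc_integrand p n a (A / sqrt n)) / of_real (E n)) \<longlonglongrightarrow> 0"
    proof (rule Lim_null_comparison [rotated])
      show "\<forall>\<^sub>F n in sequentially. norm (integral {- (pi / p)..pi / p} (arc_integrand p n a (A / sqrt n)) /
          of_real (E n)) \<le> M n * (pi / p - - (pi / p))"
        using large by eventually_elim (rule minor, use True in auto)
    qed
    then show ?thesis using True by simp
  next
    case False
    have cop: "coprime a p"
      using False a p by (intro coprime_less_prime) auto
    define w where "w = inverse (unity_root p a)"
    define L where "L = cusp_const p a * of_real (sqrt (pi * A))"
    define X where "X = (\<lambda>n. integral {- (A / sqrt n)..A / sqrt n} (arc_integrand p n a (A / sqrt n)) /
      (of_real (E n) * w ^ Suc n))"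
    have nw: "norm w = 1" by (simp add: w_def norm_inverse)
    then have w0: "w \<noteq> 0" by auto
    have X: "X \<longlonglongrightarrow> L"
      using main_arc_limit [OF p cop] unfolding X_def L_def w_def E_def A_def .
    have "(\<lambda>n. norm (X n - L) + 2 * (M n * (pi / p))) \<longlonglongrightarrow> norm (L - L) + 2 * (0 * (pi / p))"
      by (intro tendsto_intros X M)
    then have lim: "(\<lambda>n. norm (X n - L) + 2 * (M n * (pi / p))) \<longlonglongrightarrow> 0"
      by simp
    have "(\<lambda>n. integral {- (pi / p)..pi / p} (arc_integrand p n a (A / sqrt n)) / of_real (E n) - w ^ Suc n * L) \<longlonglongrightarrow> 0"
    proof (rule Lim_null_comparison [OF _ lim])
      show "\<forall>\<^sub>F n in sequentially. norm (integral {- (pi / p)..pi / p} (arc_integrand p n a (A / sqrt n)) /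
          of_real (E n) - w ^ Suc n * L) \<le> norm (X n - L) + 2 * (M n * (pi / p))"
        using large
      proof eventually_elim
        case (elim n)
        define s where "s = A / sqrt n"
        have s: "0 < s" "s \<le> pi / p" using elim A by (auto simp: s_def)
        have E: "E n > 0" using elim by (simp add: E_def)
        let ?K = "arc_integrand p n a s"
        have Mn: "M n \<ge> 0" using A by (simp add: M_def)
        define I1 I3 where "I1 = integral {- (pi / p)..- s} ?K / of_real (E n)"
          and "I3 = integral {s..pi / p} ?K / of_real (E n)"
        have "norm I1 \<le> M n * (- s - - (pi / p))"
          unfolding I1_def s_def by (rule minor) (use elim s in \<open>auto simp: s_def\<close>)
        also have "\<dots> \<le> M n * (pi / p)"
          using Mn s by (intro mult_left_mono) auto
        finally have 1: "norm I1 \<le> M n * (pi / p)" .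
        have "norm I3 \<le> M n * (pi / p - s)"
          unfolding I3_def s_def by (rule minor) (use elim s in \<open>auto simp: s_def\<close>)
        also have "\<dots> \<le> M n * (pi / p)"
          using Mn s by (intro mult_left_mono) auto
        finally have 3: "norm I3 \<le> M n * (pi / p)" .
        have "integral {- (pi / p)..pi / p} ?K = integral {- (pi / p)..- s} ?K + integral {- s..pi / p} ?K"
          using s elim int unfolding s_def
          by (intro Henstock_Kurzweil_Integration.integral_combine [symmetric]) auto
        also have "integral {- s..pi / p} ?K = integral {- s..s} ?K + integral {s..pi / p} ?K"
          using s elim int unfolding s_def
          by (intro Henstock_Kurzweil_Integration.integral_combine [symmetric]) auto
        finally have "integral {- (pi / p)..pi / p} ?K / of_real (E n) - w ^ Suc n * L =
            I1 + I3 + w ^ Suc n * (X n - L)"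
          using E w0 unfolding I1_def I3_def X_def s_def [symmetric]
          by (simp add: add_divide_distrib right_diff_distrib)
        also have "norm \<dots> \<le> norm I1 + norm I3 + norm (w ^ Suc n * (X n - L))"
          by (intro order_trans [OF norm_triangle_ineq] add_mono norm_triangle_ineq order_refl)
        also have "norm (w ^ Suc n * (X n - L)) = norm (X n - L)"
          by (simp add: norm_mult norm_power nw del: power_Suc)
        also have "norm I1 + norm I3 + norm (X n - L) \<le> M n * (pi / p) + M n * (pi / p) + norm (X n - L)"
          by (intro add_mono 1 3 order_refl)
        also have "\<dots> = norm (X n - L) + 2 * (M n * (pi / p))"
          by simp
        finally show ?case
          unfolding s_def .
      qed
    qed
    then show ?thesis
      using False by (simp add: w_def L_def)
  qed
qed

text \<open>A finite exponential sum of Kloosterman type, periodic in n with period p; it carries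
  the whole dependence on the residue class.\<close>

definition cusp_sum :: "nat \<Rightarrow> nat \<Rightarrow> complex" where
  "cusp_sum p n = (\<Sum>a=1..<p. inverse (unity_root p a) ^ Suc n * cusp_const p a)"

theorem hauptmodul_coeff_asymp:
  assumes p: "p \<in> {2, 3, 5}"
  shows "(\<lambda>n. hauptmodul_coeff p n /
      of_real (exp (4 * pi * sqrt (real n) / p) / (sqrt (2 * real p) * real n powr (3/4))) - cusp_sum p n)
    \<longlonglongrightarrow> 0"
proof -
  define A where "A = 2 * pi / p"
  define E where "E = (\<lambda>n. exp (2 * A * sqrt (real n)) / real n powr (3/4))"
  have A: "A > 0" and p0: "p > 0" using p by (auto simp: A_def)
  define f where "f = (\<lambda>n a. (if a = 0 then 0 else
      inverse (unity_root p a) ^ Suc n * (cusp_const p a * of_real (sqrt (pi * A)))))"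
  have "(\<lambda>n. \<Sum>a<p. integral {- (pi / p)..pi / p} (arc_integrand p n a (A / sqrt n)) / of_real (E n) - f n a)
      \<longlonglongrightarrow> (\<Sum>a<p. 0)"
    using arc_integral_asymp [OF p] unfolding f_def E_def A_def by (intro tendsto_sum) auto
  \<comment> \<open>The factor combines Cauchy's 1 / (2 \<pi>) with the normalisation sqrt (2 p); it
    is exactly 1 / sqrt (\<pi> A).\<close>
  then have "(\<lambda>n. of_real (sqrt (2 * real p) / (2 * pi)) * (\<Sum>a<p. integral {- (pi / p)..pi / p}
      (arc_integrand p n a (A / sqrt n)) / of_real (E n) - f n a)) \<longlonglongrightarrow> of_real (sqrt (2 * real p) / (2 * pi)) * (\<Sum>a<p. 0)"
    by (rule tendsto_mult_left)
  then have lim: "(\<lambda>n. of_real (sqrt (2 * real p) / (2 * pi)) * (\<Sum>a<p. integral {- (pi / p)..pi / p}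
      (arc_integrand p n a (A / sqrt n)) / of_real (E n) - f n a)) \<longlonglongrightarrow> 0"
    by simp
  have "\<forall>\<^sub>F n in sequentially. of_real (sqrt (2 * real p) / (2 * pi)) * (\<Sum>a<p. integral {- (pi / p)..pi / p}
      (arc_integrand p n a (A / sqrt n)) / of_real (E n) - f n a) =
      hauptmodul_coeff p n /
      of_real (exp (4 * pi * sqrt (real n) / p) / (sqrt (2 * real p) * real n powr (3/4))) - cusp_sum p n"
    using eventually_ge_at_top [of 1]
  proof eventually_elim
    case (elim n)
    have s: "A / sqrt n > 0" using A elim by simp
    have c: "(\<Sum>a<p. integral {- (pi / p)..pi / p} (arc_integrand p n a (A / sqrt n))) =
        of_real (2 * pi) * hauptmodul_coeff p n"
      by (rule hauptmodul_coeff_eq_sum_integrals [OF p elim s, symmetric])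
    have "(\<Sum>a<p. f n a) = (\<Sum>a=1..<p. f n a)"
      using p0 by (simp add: lessThan_atLeast0 sum.atLeast_Suc_lessThan f_def)
    also have "\<dots> = of_real (sqrt (pi * A)) * cusp_sum p n"
      unfolding cusp_sum_def sum_distrib_left by (intro sum.cong) (auto simp: f_def)
    finally have f: "(\<Sum>a<p. f n a) = of_real (sqrt (pi * A)) * cusp_sum p n" .
    have "sqrt (2 * real p) / (2 * pi) * sqrt (pi * A) = 1"
    proof -
      have "sqrt (2 * real p) * sqrt (pi * A) = sqrt (2 * real p * (pi * A))"
        by (simp add: real_sqrt_mult)
      also have "2 * real p * (pi * A) = (2 * pi)\<^sup>2"
        using p0 by (simp add: A_def power2_eq_square)
      finally have "sqrt (2 * real p) * sqrt (pi * A) = 2 * pi"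
        by (simp only: real_sqrt_abs) simp
      then show ?thesis by simp
    qed
    then have 1: "of_real (sqrt (2 * real p) / (2 * pi)) * of_real (sqrt (pi * A)) = (1 :: complex)"
      by (metis of_real_1 of_real_mult)
    have E: "exp (4 * pi * sqrt (real n) / p) / (sqrt (2 * real p) * real n powr (3/4)) = E n / sqrt (2 * real p)"
      by (simp add: E_def A_def mult_ac)
    have "E n \<noteq> 0" using elim by (simp add: E_def)
    have "of_real (sqrt (2 * real p) / (2 * pi)) * (\<Sum>a<p. integral {- (pi / p)..pi / p}
      (arc_integrand p n a (A / sqrt n)) / of_real (E n) - f n a) =
      of_real (sqrt (2 * real p) / (2 * pi)) * (of_real (2 * pi) * hauptmodul_coeff p n / of_real (E n)) -
        (of_real (sqrt (2 * real p) / (2 * pi)) * of_real (sqrt (pi * A))) * cusp_sum p n"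
      unfolding sum_subtractf sum_divide_distrib [symmetric] c f by (simp only: right_diff_distrib mult.assoc)
    also have "of_real (sqrt (2 * real p) / (2 * pi)) * (of_real (2 * pi) * hauptmodul_coeff p n / of_real (E n)) =
        hauptmodul_coeff p n / of_real (E n / sqrt (2 * real p))"
      using \<open>E n \<noteq> 0\<close> by (simp add: field_simps)
    finally show ?case
      unfolding 1 E by simp
  qed
  with lim show ?thesis
    by (rule Lim_transform_eventually)
qed

subsection \<open>The constants at the cusps\<close>

text \<open>1 - cis (2 x) = 2 sin x cis (x - \<pi>/2), and for 0 < x < \<pi> this angle is
  principal. The value is \<pi> times the sawtooth function at m/p; pairing it with the weights 1/2
  - r/p, which are minus a sawtooth, makes the phase of \<open>cusp_const p a\<close> equal to
  -\<pi> e s(a, p) with s the Dedekind sum.\<close>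

lemma Im_Ln_one_minus_unity_root:
  assumes p: "p > 0" and m: "\<not> p dvd m"
  shows "Im (Ln (1 - unity_root p m)) = pi * (real (m mod p) / p - 1 / 2)"
proof -
  define x where "x = pi * real (m mod p) / p"
  have "0 < m mod p" "m mod p < p"
    using assms by (auto simp: dvd_eq_mod_eq_0)
  then have x: "0 < x" "x < pi"
    by (auto simp: x_def field_simps)
  then have "sin x > 0"
    by (rule sin_gt_zero)
  have "unity_root p m = unity_root p 1 ^ (m mod p + p * (m div p))"
    by (simp add: unity_root_power)
  also have "\<dots> = unity_root p (m mod p)"
    unfolding power_add power_mult unity_root_power_eq_1 [OF p] by (simp add: unity_root_power)
  also have "unity_root p (m mod p) = cis (2 * x)"
    by (simp add: unity_root_def x_def mult_ac)
  finally have eq: "1 - unity_root p m = rcis (2 * sin x) (x - pi / 2)"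
    by (simp add: complex_eq_iff rcis_def cos_diff sin_diff cos_double_sin sin_double power2_eq_square)
  have Ln: "Ln (rcis (2 * sin x) (x - pi / 2)) = Complex (ln (2 * sin x)) (x - pi / 2)"
    using x \<open>sin x > 0\<close> by (intro Ln_rcis) auto
  show ?thesis
    unfolding eq Ln by (simp add: x_def algebra_simps)
qed

lemma inverse_unique_left:
  fixes u v w :: complex
  assumes "u * v = 1" "v * w = 1"
  shows "u = w"
proof -
  have "u = u * (v * w)" using assms by simp
  also have "\<dots> = (u * v) * w" by (simp only: mult.assoc)
  finally show ?thesis using assms by simp
qed

text \<open>The moduli of the factors cancel because \<open>r\<close> and \<open>p - r\<close> give conjugate roots of unity
  with opposite exponents.\<close>

lemma cusp_const_eq_cis:
  assumes p: "p > 0" and a: "coprime a p"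
  shows "cusp_const p a = cis (eta_exponent p *
    (\<Sum>r=1..<p. (1/2 - real r / real p) * (pi * (real (a * r mod p) / p - 1 / 2))))"
proof -
  have nd: "\<not> p dvd a * r" if "r \<in> {1..<p}" for r
    using a that by (auto simp: coprime_commute coprime_dvd_mult_right_iff dest: dvd_imp_le)
  define S where "S = (\<Sum>r=1..<p. of_real (1/2 - real r / real p) * Ln (1 - unity_root p a ^ r))"
  define c where "c = (\<lambda>r. (1/2 - real r / real p) * ln (norm (1 - unity_root p a ^ r)))"
  have "Re S = (\<Sum>r=1..<p. c r)"
    unfolding S_def c_def Re_sum
  proof (rule sum.cong [OF refl])
    fix r assume "r \<in> {1..<p}"
    then have "1 - unity_root p a ^ r \<noteq> 0"
      using nd p by (simp add: unity_root_power unity_root_eq_1_iff)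
    then show "Re (of_real (1/2 - real r / real p) * Ln (1 - unity_root p a ^ r)) =
        (1/2 - real r / real p) * ln (norm (1 - unity_root p a ^ r))"
      by simp
  qed
  also have "(\<Sum>r=1..<p. c r) = (\<Sum>r=1..<p. - c r)"
  proof (rule sum.reindex_bij_witness [of _ "\<lambda>r. p - r" "\<lambda>r. p - r"])
    fix r assume r: "r \<in> {1..<p}"
    have "unity_root p a ^ (p - r) * unity_root p a ^ r = 1"
      using r p by (simp add: power_add [symmetric])
    moreover have "unity_root p a ^ r * cnj (unity_root p a ^ r) = 1"
      unfolding complex_norm_square [symmetric] by (simp add: norm_power)
    ultimately have "unity_root p a ^ (p - r) = cnj (unity_root p a ^ r)"
      by (rule inverse_unique_left)
    then have "norm (1 - unity_root p a ^ (p - r)) = norm (cnj (1 - unity_root p a ^ r))"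
      by simp
    also have "\<dots> = norm (1 - unity_root p a ^ r)"
      by (rule complex_mod_cnj)
    finally show "- c (p - r) = c r"
      using r p by (simp add: c_def field_simps of_nat_diff)
  qed auto
  also have "\<dots> = - Re S"
    using \<open>Re S = (\<Sum>r=1..<p. c r)\<close> by (simp add: sum_negf)
  finally have "Re S = 0" by simp
  moreover have "Im S = (\<Sum>r=1..<p. (1/2 - real r / real p) * (pi * (real (a * r mod p) / p - 1 / 2)))"
    unfolding S_def Im_sum
  proof (rule sum.cong [OF refl])
    fix r assume "r \<in> {1..<p}"
    then have "Im (Ln (1 - unity_root p a ^ r)) = pi * (real (a * r mod p) / p - 1 / 2)"
      using Im_Ln_one_minus_unity_root [OF p nd] by (simp add: unity_root_power)
    then show "Im (of_real (1/2 - real r / real p) * Ln (1 - unity_root p a ^ r)) =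
        (1/2 - real r / real p) * (pi * (real (a * r mod p) / p - 1 / 2))"
      by simp
  qed
  ultimately have "of_nat (eta_exponent p) * S = \<i> * of_real (eta_exponent p *
      (\<Sum>r=1..<p. (1/2 - real r / real p) * (pi * (real (a * r mod p) / p - 1 / 2))))"
    by (simp add: complex_eq_iff)
  then show ?thesis
    by (simp only: cusp_const_def S_def cis_conv_exp)
qed

lemma cis_eq_unity_root:
  assumes "p > 0" "\<theta> = 2 * pi * (real m / p - real k)"
  shows "cis \<theta> = unity_root p m"
proof -
  have "cis \<theta> = cis (2 * pi * real m / real p) / cis (2 * pi * real k)"
    unfolding cis_divide by (rule arg_cong [where f = cis]) (simp add: assms(2) right_diff_distrib)
  then show ?thesis
    by (simp add: unity_root_def cis_multiple_2pi)
qed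

text \<open>The Dedekind sums are s(1,2) = 0, s(1,3) = 1/18, s(1,5) = 1/5, s(2,5) = 0, and s(p - a,
  p) = -s(a, p). The last instantiation in each case counts the full turns to be removed: 1 where
  the phase is negative, 0 otherwise.\<close>

lemma cusp_const_values:
  "cusp_const 2 1 = unity_root 2 0"
  "cusp_const 3 1 = unity_root 3 2" "cusp_const 3 2 = unity_root 3 1"
  "cusp_const 5 1 = unity_root 5 2" "cusp_const 5 2 = unity_root 5 0"
  "cusp_const 5 3 = unity_root 5 0" "cusp_const 5 4 = unity_root 5 3"
proof -
  have sums: "(\<Sum>r=1..<2. f r) = f 1" "(\<Sum>r=1..<3. f r) = f 1 + f 2"
    "(\<Sum>r=1..<5. f r) = f 1 + f 2 + f 3 + f 4" for f :: "nat \<Rightarrow> real"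
    by (simp_all add: eval_nat_numeral)
  have cop: "coprime 1 (2 :: nat)" "coprime 1 (3 :: nat)" "coprime 2 (3 :: nat)" "coprime 1 (5 :: nat)"
    "coprime 2 (5 :: nat)" "coprime 3 (5 :: nat)" "coprime 4 (5 :: nat)"
    by (simp_all add: coprime_less_prime)
  show "cusp_const 2 1 = unity_root 2 0"
    unfolding cusp_const_eq_cis [OF zero_less_numeral cop(1)] sums
    by (rule cis_eq_unity_root [of _ _ _ 0]) (simp_all add: eta_exponent_def field_simps)
  show "cusp_const 3 1 = unity_root 3 2"
    unfolding cusp_const_eq_cis [OF zero_less_numeral cop(2)] sums
    by (rule cis_eq_unity_root [of _ _ _ 1]) (simp_all add: eta_exponent_def field_simps)
  show "cusp_const 3 2 = unity_root 3 1"
    unfolding cusp_const_eq_cis [OF zero_less_numeral cop(3)] sums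
    by (rule cis_eq_unity_root [of _ _ _ 0]) (simp_all add: eta_exponent_def field_simps)
  show "cusp_const 5 1 = unity_root 5 2"
    unfolding cusp_const_eq_cis [OF zero_less_numeral cop(4)] sums
    by (rule cis_eq_unity_root [of _ _ _ 1]) (simp_all add: eta_exponent_def field_simps)
  show "cusp_const 5 2 = unity_root 5 0"
    unfolding cusp_const_eq_cis [OF zero_less_numeral cop(5)] sums
    by (rule cis_eq_unity_root [of _ _ _ 0]) (simp_all add: eta_exponent_def field_simps)
  show "cusp_const 5 3 = unity_root 5 0"
    unfolding cusp_const_eq_cis [OF zero_less_numeral cop(6)] sums
    by (rule cis_eq_unity_root [of _ _ _ 0]) (simp_all add: eta_exponent_def field_simps)
  show "cusp_const 5 4 = unity_root 5 3"
    unfolding cusp_const_eq_cis [OF zero_less_numeral cop(7)] sums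
    by (rule cis_eq_unity_root [of _ _ _ 0]) (simp_all add: eta_exponent_def field_simps)
qed

section \<open>Evaluation of the exponential sums\<close>

lemma cusp_term_eq:
  assumes p: "p > 0" and a: "a < p"
  shows "inverse (unity_root p a) ^ Suc n * unity_root p m = unity_root p (((p - a) * Suc n + m) mod p)"
proof -
  define j where "j = (p - a) * Suc n + m"
  have "unity_root p (p - a) * unity_root p a = unity_root p 1 ^ (p - a + a)"
    unfolding power_add by (simp add: unity_root_power)
  also have "\<dots> = 1"
    using p a by simp
  finally have inv: "inverse (unity_root p a) = unity_root p (p - a)"
    by (metis inverse_unique mult.commute)
  have "inverse (unity_root p a) ^ Suc n * unity_root p m = unity_root p 1 ^ (j mod p + p * (j div p))"
    unfolding inv mod_mult_div_eq j_def power_add by (simp add: unity_root_power del: power_Suc mult_Suc_right)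
  also have "\<dots> = unity_root p (j mod p)"
    unfolding power_add power_mult unity_root_power_eq_1 [OF p] by (simp add: unity_root_power)
  finally show ?thesis
    by (simp only: j_def)
qed

text \<open>These are the two quadratic Gaussian periods, the roots of x^2 + x - 1; positivity of
  cos (2 \<pi>/5) tells which is which.\<close>

lemma unity_root_5_sums:
  "unity_root 5 1 + unity_root 5 4 = of_real ((sqrt 5 - 1) / 2)"
  "unity_root 5 2 + unity_root 5 3 = of_real (- (1 + sqrt 5) / 2)"
proof -
  define z where "z = unity_root 5 1"
  have pow: "unity_root 5 m = z ^ m" for m
    by (simp add: z_def unity_root_power)
  have z5: "z ^ 5 = 1" by (simp add: z_def)
  have sum0: "1 + z + z ^ 2 + z ^ 3 + z ^ 4 = 0"
  proof -
    have "z \<noteq> 1" by (simp add: z_def unity_root_eq_1_iff)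
    moreover have "(z - 1) * (1 + z + z ^ 2 + z ^ 3 + z ^ 4) = z ^ 5 - 1"
      by (simp add: algebra_simps eval_nat_numeral)
    ultimately show ?thesis using z5 by simp
  qed
  define x where "x = 2 * cos (2 * pi / 5)"
  have "z ^ 4 = cnj z"
  proof -
    have "z ^ 4 * z = 1" using z5 by (simp add: eval_nat_numeral mult_ac)
    moreover have "z * cnj z = 1" by (simp add: complex_norm_square [symmetric] z_def)
    ultimately show ?thesis by (rule inverse_unique_left)
  qed
  then have x: "z + z ^ 4 = of_real x"
    by (simp add: complex_add_cnj x_def z_def unity_root_def)
  \<comment> \<open>Written as an identity of polynomials in z, so that both brackets on the right
    vanish afterwards.\<close>
  have "(z + z ^ 4)\<^sup>2 + (z + z ^ 4) - 1 = (1 + z + z ^ 2 + z ^ 3 + z ^ 4) + (z ^ 3 + 2) * (z ^ 5 - 1)"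
    by (simp add: algebra_simps eval_nat_numeral)
  then have "of_real (x\<^sup>2 + x - 1) = (0 :: complex)"
    unfolding x sum0 z5 by simp
  then have "x\<^sup>2 + x - 1 = 0"
    by (simp only: of_real_eq_0_iff)
  then have "(2 * x + 1)\<^sup>2 = 5"
    by (simp add: power2_eq_square algebra_simps)
  moreover have "x > 0"
    unfolding x_def by (intro mult_pos_pos cos_gt_zero) (simp_all add: field_simps)
  ultimately have "2 * x + 1 = sqrt 5"
    by (intro real_sqrt_unique [symmetric]) auto
  then have "x = (sqrt 5 - 1) / 2" by simp
  with x show "unity_root 5 1 + unity_root 5 4 = of_real ((sqrt 5 - 1) / 2)"
    unfolding pow by simp
  have "z ^ 2 + z ^ 3 = - 1 - (z + z ^ 4)"
    using sum0 by (simp add: algebra_simps eq_neg_iff_add_eq_0)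
  then show "unity_root 5 2 + unity_root 5 3 = of_real (- (1 + sqrt 5) / 2)"
    unfolding pow x \<open>x = (sqrt 5 - 1) / 2\<close> by (simp add: field_simps)
qed

lemma unity_root_0 [simp]: "unity_root p 0 = 1"
  by (simp add: unity_root_def)

lemma cusp_sum_2: "cusp_sum 2 n = of_real (if n mod 2 = 0 then -1 else 1)"
proof -
  have "unity_root 2 1 = -1"
    by (simp add: unity_root_def)
  moreover have "{1..<2} = {1 :: nat}" by auto
  ultimately have "cusp_sum 2 n = (-1) ^ Suc n"
    by (simp add: cusp_sum_def cusp_const_values(1) [unfolded One_nat_def] del: power_Suc)
  then show ?thesis
    by (auto simp: even_iff_mod_2_eq_zero [symmetric])
qed

lemma cusp_sum_3:
  "cusp_sum 3 n = unity_root 3 ((2 * Suc n + 2) mod 3) + unity_root 3 ((1 * Suc n + 1) mod 3)"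
proof -
  have "cusp_sum 3 n = inverse (unity_root 3 1) ^ Suc n * cusp_const 3 1 +
      inverse (unity_root 3 2) ^ Suc n * cusp_const 3 2"
    unfolding cusp_sum_def by (simp add: eval_nat_numeral del: power_Suc)
  then show ?thesis
    unfolding cusp_const_values
    using cusp_term_eq [of 3 1 n 2] cusp_term_eq [of 3 2 n 1]
    by (simp del: power_Suc mult_Suc_right)
qed

text \<open>The terms of a and 5 - a are grouped: their exponents add up to a multiple of 5, so each
  group is a conjugate pair with a real sum.\<close>

lemma cusp_sum_5:
  "cusp_sum 5 n = unity_root 5 ((4 * Suc n + 2) mod 5) + unity_root 5 ((1 * Suc n + 3) mod 5) +
    (unity_root 5 ((3 * Suc n + 0) mod 5) + unity_root 5 ((2 * Suc n + 0) mod 5))"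
proof -
  have "cusp_sum 5 n = (inverse (unity_root 5 1) ^ Suc n * cusp_const 5 1 +
      inverse (unity_root 5 4) ^ Suc n * cusp_const 5 4) +
      (inverse (unity_root 5 2) ^ Suc n * cusp_const 5 2 +
      inverse (unity_root 5 3) ^ Suc n * cusp_const 5 3)"
    unfolding cusp_sum_def by (simp add: eval_nat_numeral del: power_Suc)
  then show ?thesis
    unfolding cusp_const_values
    using cusp_term_eq [of 5 1 n 2] cusp_term_eq [of 5 4 n 3] cusp_term_eq [of 5 2 n 0]
      cusp_term_eq [of 5 3 n 0]
    by (simp del: power_Suc mult_Suc_right)
qed

lemma unity_root_3_sum: "unity_root 3 1 + unity_root 3 2 = -1"
proof -
  define z where "z = unity_root 3 1"
  have "z ^ 3 = 1" "z \<noteq> 1"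
    by (simp_all add: z_def unity_root_eq_1_iff)
  moreover have "(z - 1) * (1 + z + z ^ 2) = z ^ 3 - 1"
    by (simp add: algebra_simps eval_nat_numeral)
  ultimately have "1 + z + z ^ 2 = 0" by simp
  moreover have "unity_root 3 2 = z ^ 2"
    by (simp add: z_def unity_root_power)
  ultimately show ?thesis
    unfolding z_def [symmetric] by (simp add: add_ac eq_neg_iff_add_eq_0)
qed

text \<open>Dividing the difference by v n gives the quotient limit as soon as |v n| stays above a
  fixed c > 0; a residue class with vanishing sum would break this.\<close>

lemma hauptmodul_coeff_asymp_equiv:
  fixes v :: "nat \<Rightarrow> real"
  assumes p: "p \<in> {2, 3, 5}" and v: "\<And>n. cusp_sum p n = of_real (v n)"
    and c: "c > 0" "\<And>n. c \<le> \<bar>v n\<bar>"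
  shows "hauptmodul_coeff p \<sim>[at_top] (\<lambda>n. complex_of_real (
    exp (4 * pi * sqrt (real n) / p) / (sqrt (2 * real p) * real n powr (3/4)) * v n))"
proof (rule asymp_equivI')
  define E where "E = (\<lambda>n. exp (4 * pi * sqrt (real n) / p) / (sqrt (2 * real p) * real n powr (3/4)))"
  have v0: "v n \<noteq> 0" for n
    using c(1) c(2) [of n] by auto
  have lim: "(\<lambda>n. norm (hauptmodul_coeff p n / of_real (E n) - of_real (v n)) / c) \<longlonglongrightarrow> 0"
    using tendsto_divide [OF tendsto_norm [OF hauptmodul_coeff_asymp [OF p]] tendsto_const, of c] c(1)
    unfolding v E_def by simp
  have "(\<lambda>n. hauptmodul_coeff p n / of_real (E n * v n) - 1) \<longlonglongrightarrow> 0"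
  proof (rule Lim_null_comparison [OF _ lim], intro always_eventually allI)
    fix n
    have "hauptmodul_coeff p n / of_real (E n * v n) - 1 =
        (hauptmodul_coeff p n / of_real (E n) - of_real (v n)) / of_real (v n)"
      using v0 [of n] by (simp add: diff_divide_distrib)
    then have "norm (hauptmodul_coeff p n / of_real (E n * v n) - 1) =
        norm (hauptmodul_coeff p n / of_real (E n) - of_real (v n)) / \<bar>v n\<bar>"
      by (simp add: norm_divide)
    also have "\<dots> \<le> norm (hauptmodul_coeff p n / of_real (E n) - of_real (v n)) / c"
      using c v0 [of n] by (intro divide_left_mono) auto
    finally show "norm (hauptmodul_coeff p n / of_real (E n * v n) - 1) \<le>
        norm (hauptmodul_coeff p n / of_real (E n) - of_real (v n)) / c" .
  qed
  then show "(\<lambda>n. hauptmodul_coeff p n / complex_of_real (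
      exp (4 * pi * sqrt (real n) / p) / (sqrt (2 * real p) * real n powr (3/4)) * v n)) \<longlonglongrightarrow> 1"
    unfolding E_def by (rule LIM_zero_cancel)
qed

theorem theorem1p2:
  shows "(hauptmodul_coeff 2 \<sim>[at_top] (\<lambda>n. complex_of_real (
           exp (2 * pi * sqrt (real n)) / (2 * real n powr (3/4)) *
           (if n mod 2 = 0 then -1 else 1)))) \<and>
         (hauptmodul_coeff 3 \<sim>[at_top] (\<lambda>n. complex_of_real (
           exp (4 * pi * sqrt (real n) / 3) / (sqrt 6 * real n powr (3/4)) *
           (if n mod 3 = 1 then 2 else -1)))) \<and>
         (hauptmodul_coeff 5 \<sim>[at_top] (\<lambda>n. complex_of_real (
           exp (4 * pi * sqrt (real n) / 5) / (sqrt 10 * real n powr (3/4)) *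
           (if n mod 5 = 0 then -1
            else if n mod 5 = 1 then (3 + sqrt 5) / 2
            else if n mod 5 = 2 then -1 + sqrt 5
            else if n mod 5 = 3 then -1 - sqrt 5
            else (3 - sqrt 5) / 2))))"
proof (intro conjI)
  \<comment> \<open>Here and in the next facts: the reduced exponents of the cusp terms in each
    residue class. Equal exponents 0 mark the classes where terms add up to 2.\<close>
  have r3_0: "(2 * Suc n + 2) mod 3 = 1" "(1 * Suc n + 1) mod 3 = 2" if "n mod 3 = 0" for n
    using that by presburger+
  have r3_1: "(2 * Suc n + 2) mod 3 = 0" "(1 * Suc n + 1) mod 3 = 0" if "n mod 3 = 1" for n
    using that by presburger+
  have r3_2: "(2 * Suc n + 2) mod 3 = 2" "(1 * Suc n + 1) mod 3 = 1" if "n mod 3 = 2" for n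
    using that by presburger+
  have r5_0: "(4 * Suc n + 2) mod 5 = 1" "(1 * Suc n + 3) mod 5 = 4"
    "(3 * Suc n + 0) mod 5 = 3" "(2 * Suc n + 0) mod 5 = 2" if "n mod 5 = 0" for n
    using that by presburger+
  have r5_1: "(4 * Suc n + 2) mod 5 = 0" "(1 * Suc n + 3) mod 5 = 0"
    "(3 * Suc n + 0) mod 5 = 1" "(2 * Suc n + 0) mod 5 = 4" if "n mod 5 = 1" for n
    using that by presburger+
  have r5_2: "(4 * Suc n + 2) mod 5 = 4" "(1 * Suc n + 3) mod 5 = 1"
    "(3 * Suc n + 0) mod 5 = 4" "(2 * Suc n + 0) mod 5 = 1" if "n mod 5 = 2" for n
    using that by presburger+
  have r5_3: "(4 * Suc n + 2) mod 5 = 3" "(1 * Suc n + 3) mod 5 = 2"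
    "(3 * Suc n + 0) mod 5 = 2" "(2 * Suc n + 0) mod 5 = 3" if "n mod 5 = 3" for n
    using that by presburger+
  have r5_4: "(4 * Suc n + 2) mod 5 = 2" "(1 * Suc n + 3) mod 5 = 3"
    "(3 * Suc n + 0) mod 5 = 0" "(2 * Suc n + 0) mod 5 = 0" if "n mod 5 = 4" for n
    using that by presburger+
  have u3: "unity_root 3 2 + unity_root 3 1 = -1"
    using unity_root_3_sum by (simp only: add.commute)
  have sum_3: "cusp_sum 3 n = of_real (if n mod 3 = 1 then 2 else -1)" for n
  proof -
    have "n mod 3 < 3" by simp
    then consider "n mod 3 = 0" | "n mod 3 = 1" | "n mod 3 = 2"
      by linarith
    then show ?thesis
    proof cases
      case 1
      then show ?thesis
        unfolding cusp_sum_3 r3_0 [OF 1] by (simp only: u3 unity_root_3_sum) simp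
    next
      case 2
      then show ?thesis
        unfolding cusp_sum_3 r3_1 [OF 2] by simp
    next
      case 3
      then show ?thesis
        unfolding cusp_sum_3 r3_2 [OF 3] by (simp only: u3 unity_root_3_sum) simp
    qed
  qed
  have u5: "unity_root 5 4 + unity_root 5 1 = of_real ((sqrt 5 - 1) / 2)"
    "unity_root 5 3 + unity_root 5 2 = of_real (- (1 + sqrt 5) / 2)"
    using unity_root_5_sums by (simp_all only: add.commute)
  have sum_5: "cusp_sum 5 n = of_real (if n mod 5 = 0 then -1
            else if n mod 5 = 1 then (3 + sqrt 5) / 2
            else if n mod 5 = 2 then -1 + sqrt 5
            else if n mod 5 = 3 then -1 - sqrt 5
            else (3 - sqrt 5) / 2)" for n
  proof -
    have "n mod 5 < 5" by simp
    then consider "n mod 5 = 0" | "n mod 5 = 1" | "n mod 5 = 2" | "n mod 5 = 3" | "n mod 5 = 4"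
      by linarith
    then show ?thesis
    proof cases
      case 1
      then show ?thesis
        unfolding cusp_sum_5 r5_0 [OF 1] by (simp only: u5 unity_root_5_sums) (simp flip: of_real_add add: field_simps)
    next
      case 2
      then show ?thesis
        unfolding cusp_sum_5 r5_1 [OF 2] by (simp only: u5 unity_root_5_sums) (simp add: field_simps)
    next
      case 3
      then show ?thesis
        unfolding cusp_sum_5 r5_2 [OF 3] by (simp only: u5 unity_root_5_sums) (simp flip: of_real_add add: field_simps)
    next
      case 4
      then show ?thesis
        unfolding cusp_sum_5 r5_3 [OF 4] by (simp only: u5 unity_root_5_sums) (simp flip: of_real_add add: field_simps)
    next
      case 5
      then show ?thesis
        unfolding cusp_sum_5 r5_4 [OF 5] by (simp only: u5 unity_root_5_sums) (simp flip: of_real_add add: field_simps)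
    qed
  qed
  have "hauptmodul_coeff 2 \<sim>[at_top] (\<lambda>n. complex_of_real (
           exp (4 * pi * sqrt (real n) / real 2) / (sqrt (2 * real 2) * real n powr (3/4)) *
           (if n mod 2 = 0 then -1 else 1)))"
    by (rule hauptmodul_coeff_asymp_equiv [OF _ cusp_sum_2, of 1]) auto
  moreover have "4 * pi * sqrt (real n) / real 2 = 2 * pi * sqrt (real n)" "sqrt (2 * real 2) = 2" for n
    by simp_all
  ultimately show "hauptmodul_coeff 2 \<sim>[at_top] (\<lambda>n. complex_of_real (
           exp (2 * pi * sqrt (real n)) / (2 * real n powr (3/4)) *
           (if n mod 2 = 0 then -1 else 1)))"
    by (simp only:)
  have "hauptmodul_coeff 3 \<sim>[at_top] (\<lambda>n. complex_of_real (
           exp (4 * pi * sqrt (real n) / real 3) / (sqrt (2 * real 3) * real n powr (3/4)) *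
           (if n mod 3 = 1 then 2 else -1)))"
    by (rule hauptmodul_coeff_asymp_equiv [OF _ sum_3, of 1]) auto
  moreover have "real 3 = 3" "sqrt (2 * 3) = sqrt 6"
    by simp_all
  ultimately show "hauptmodul_coeff 3 \<sim>[at_top] (\<lambda>n. complex_of_real (
           exp (4 * pi * sqrt (real n) / 3) / (sqrt 6 * real n powr (3/4)) *
           (if n mod 3 = 1 then 2 else -1)))"
    by (simp only:)
  \<comment> \<open>The smallest of the five moduli is (3 - sqrt 5)/2; sqrt 5 \<le> 5/2 keeps it
    above the bound 1/4 used next.\<close>
  have "2 \<le> sqrt (5 :: real)" "sqrt (5 :: real) \<le> 5 / 2"
    by (rule real_le_rsqrt, simp) (rule real_le_lsqrt, simp_all add: power2_eq_square)
  then have "hauptmodul_coeff 5 \<sim>[at_top] (\<lambda>n. complex_of_real (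
           exp (4 * pi * sqrt (real n) / real 5) / (sqrt (2 * real 5) * real n powr (3/4)) *
           (if n mod 5 = 0 then -1
            else if n mod 5 = 1 then (3 + sqrt 5) / 2
            else if n mod 5 = 2 then -1 + sqrt 5
            else if n mod 5 = 3 then -1 - sqrt 5
            else (3 - sqrt 5) / 2)))"
    by (intro hauptmodul_coeff_asymp_equiv [OF _ sum_5, of "1 / 4"]) auto
  moreover have "real 5 = 5" "sqrt (2 * 5) = sqrt 10"
    by simp_all
  ultimately show "hauptmodul_coeff 5 \<sim>[at_top] (\<lambda>n. complex_of_real (
           exp (4 * pi * sqrt (real n) / 5) / (sqrt 10 * real n powr (3/4)) *
           (if n mod 5 = 0 then -1
            else if n mod 5 = 1 then (3 + sqrt 5) / 2
            else if n mod 5 = 2 then -1 + sqrt 5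
            else if n mod 5 = 3 then -1 - sqrt 5
            else (3 - sqrt 5) / 2)))"
    by (simp only:)
qed

end
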